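(* Let $A$ be a Banach algebra, let $X$ be a Banach $A$-bimodule, let $n\ge 0$ be an even integer, and let $T,S:A^{(n)}\to A^{(n)}$ be continuous linear mappings. Suppose that for every $x^{(n+2)}\in X^{(n+2)}$ the mapping $a^{(n+2)}\mapsto x^{(n+2)}T''(a^{(n+2)})$ from $A^{(n+2)}$ into $X^{(n+2)}$ is weak$^*$-to-weak continuous. If $D:A^{(n)}\to X^{(n+1)}$ is a $T$-$S$-derivation, then $D'':A^{(n+2)}\to X^{(n+3)}$ is a $T''$-$S''$-derivation.
   Context: $A^{(n)}$, $X^{(n)}$ denote the $n$-th duals of $A$, $X$, with $A^{(0)}=A$, $X^{(0)}=X$. For a bounded linear map $T$, $T''$ is its second adjoint. The weak$^*$ topology on $A^{(n+2)}$ is $\sigma(A^{(n+2)},A^{(n+1)})$ and the weak topology on $X^{(n+2)}$ is $\sigma(X^{(n+2)},X^{(n+3)})$. For a Banach algebra $B$, the first Arens product on $B^{**}$ is defined by $\langle b'b,c\rangle=\langle b',bc\rangle$, $\langle b''b',b\rangle=\langle b'',b'b\rangle$, $\langle a''b'',b'\rangle=\langle a'',b''b'\rangle$ for $b,c\in B$, $b'\in B^*$, $a'',b''\in B^{**}$. If $Y$ is a Banach $B$-bimodule, then $Y^*$ is the dual $B$-bimodule: $\langle y'b,y\rangle=\langle y',by\rangle$, $\langle by',y\rangle=\langle y',yb\rangle$; and $Y^{**}$ is a Banach $B^{**}$-bimodule ($B^{**}$ with the first Arens product) with $b''y''=w^*\text{-}\lim_\alpha\lim_\beta b_\alpha y_\beta$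 and $y''b''=w^*\text{-}\lim_\beta\lim_\alpha y_\beta b_\alpha$ whenever $(b_\alpha)\subseteq B$, $(y_\beta)\subseteq Y$ are bounded nets converging weak$^*$ to $b''$, $y''$. Iterating, for even $n$, $A^{(n)}$ is a Banach algebra, $X^{(n)}$ is a Banach $A^{(n)}$-bimodule, and $X^{(n+1)}$ is its dual $A^{(n)}$-bimodule (likewise $X^{(n+3)}$ is the dual $A^{(n+2)}$-bimodule of $X^{(n+2)}$). For a Banach algebra $B$, a Banach $B$-bimodule $Y$ and continuous linear maps $T,S:B\to B$, a bounded linear map $D:B\to Y$ is a $T$-$S$-derivation if $D(xy)=T(x)D(y)+D(x)S(y)$ for all $x,y\in B$. *)

theory Defs
  imports "HOL-Analysis.Analysis"
begin

text \<open>
  The type of the \<open>n\<close>-th dual of a space depends on \<open>n\<close>, so spaces are given by carriers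
  inside an ambient additive group, and \<open>n\<close> can be quantified over.  The scalars are a type of
  sort \<open>{real_normed_field, euclidean_space}\<close>; up to isomorphism these are exactly the real and
  the complex numbers.
\<close>

record ('k, 'u) nspace =
  carrier :: "'u set"
  scl :: "'k \<Rightarrow> 'u \<Rightarrow> 'u"
  nrm :: "'u \<Rightarrow> real"

definition scalars :: "('k::real_normed_field, 'k) nspace" where
  "scalars = \<lparr>carrier = UNIV, scl = (*), nrm = norm\<rparr>"

definition normed_space :: "('k::real_normed_field, 'u::ab_group_add) nspace \<Rightarrow> bool" where
  "normed_space E \<longleftrightarrow>
     vector_space (scl E) \<and> module.subspace (scl E) (carrier E) \<and>
     (\<forall>x\<in>carrier E. 0 \<le> nrm E x \<and> (nrm E x = 0 \<longleftrightarrow> x = 0)) \<and>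
     (\<forall>x\<in>carrier E. \<forall>y\<in>carrier E. nrm E (x + y) \<le> nrm E x + nrm E y) \<and>
     (\<forall>c. \<forall>x\<in>carrier E. nrm E (scl E c x) = norm c * nrm E x)"

definition banach_space :: "('k::real_normed_field, 'u::ab_group_add) nspace \<Rightarrow> bool" where
  "banach_space E \<longleftrightarrow> normed_space E \<and>
     (\<forall>s :: nat \<Rightarrow> 'u. range s \<subseteq> carrier E \<and>
        (\<forall>e>0. \<exists>M. \<forall>i\<ge>M. \<forall>j\<ge>M. nrm E (s i - s j) < e) \<longrightarrow>
        (\<exists>l\<in>carrier E. (\<lambda>i. nrm E (s i - l)) \<longlonglongrightarrow> 0))"

text \<open>Maps between spaces are only constrained on the carrier of their domain.\<close>

definition linear_map ::
  "('k::real_normed_field, 'u::ab_group_add) nspace \<Rightarrow> ('k, 'v::ab_group_add) nspace \<Rightarrow>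
   ('u \<Rightarrow> 'v) \<Rightarrow> bool" where
  "linear_map E F f \<longleftrightarrow>
     (\<forall>x\<in>carrier E. f x \<in> carrier F) \<and>
     (\<forall>x\<in>carrier E. \<forall>y\<in>carrier E. f (x + y) = f x + f y) \<and>
     (\<forall>c. \<forall>x\<in>carrier E. f (scl E c x) = scl F c (f x))"

definition bounded_linear_map ::
  "('k::real_normed_field, 'u::ab_group_add) nspace \<Rightarrow> ('k, 'v::ab_group_add) nspace \<Rightarrow>
   ('u \<Rightarrow> 'v) \<Rightarrow> bool" where
  "bounded_linear_map E F f \<longleftrightarrow>
     linear_map E F f \<and> (\<exists>C. \<forall>x\<in>carrier E. nrm F (f x) \<le> C * nrm E x)"

definition bilinear_map ::
  "('k::real_normed_field, 'u::ab_group_add) nspace \<Rightarrow> ('k, 'v::ab_group_add) nspace \<Rightarrow>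
   ('k, 'w::ab_group_add) nspace \<Rightarrow> ('u \<Rightarrow> 'v \<Rightarrow> 'w) \<Rightarrow> bool" where
  "bilinear_map E F G b \<longleftrightarrow>
     (\<forall>x\<in>carrier E. linear_map F G (b x)) \<and> (\<forall>y\<in>carrier F. linear_map E G (\<lambda>x. b x y))"

definition banach_algebra ::
  "('k::real_normed_field, 'u::ab_group_add) nspace \<Rightarrow> ('u \<Rightarrow> 'u \<Rightarrow> 'u) \<Rightarrow> bool" where
  "banach_algebra B m \<longleftrightarrow>
     banach_space B \<and> bilinear_map B B B m \<and>
     (\<forall>a\<in>carrier B. \<forall>b\<in>carrier B. \<forall>c\<in>carrier B. m (m a b) c = m a (m b c)) \<and>
     (\<forall>a\<in>carrier B. \<forall>b\<in>carrier B. nrm B (m a b) \<le> nrm B a * nrm B b)"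

definition banach_bimodule ::
  "('k::real_normed_field, 'u::ab_group_add) nspace \<Rightarrow> ('u \<Rightarrow> 'u \<Rightarrow> 'u) \<Rightarrow>
   ('k, 'v::ab_group_add) nspace \<Rightarrow> ('u \<Rightarrow> 'v \<Rightarrow> 'v) \<Rightarrow> ('v \<Rightarrow> 'u \<Rightarrow> 'v) \<Rightarrow> bool" where
  "banach_bimodule B m Y l r \<longleftrightarrow>
     banach_space Y \<and> bilinear_map B Y Y l \<and> bilinear_map Y B Y r \<and>
     (\<forall>a\<in>carrier B. \<forall>b\<in>carrier B. \<forall>y\<in>carrier Y.
        l (m a b) y = l a (l b y) \<and> r y (m a b) = r (r y a) b \<and> r (l a y) b = l a (r y b)) \<and>
     (\<exists>K. \<forall>a\<in>carrier B. \<forall>y\<in>carrier Y.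
        nrm Y (l a y) \<le> K * nrm B a * nrm Y y \<and> nrm Y (r y a) \<le> K * nrm B a * nrm Y y)"

definition ts_derivation ::
  "('k::real_normed_field, 'u::ab_group_add) nspace \<Rightarrow> ('u \<Rightarrow> 'u \<Rightarrow> 'u) \<Rightarrow>
   ('k, 'v::ab_group_add) nspace \<Rightarrow> ('u \<Rightarrow> 'v \<Rightarrow> 'v) \<Rightarrow> ('v \<Rightarrow> 'u \<Rightarrow> 'v) \<Rightarrow>
   ('u \<Rightarrow> 'u) \<Rightarrow> ('u \<Rightarrow> 'u) \<Rightarrow> ('u \<Rightarrow> 'v) \<Rightarrow> bool" where
  "ts_derivation B m Y l r T S D \<longleftrightarrow>
     bounded_linear_map B B T \<and> bounded_linear_map B B S \<and> bounded_linear_map B Y D \<and>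
     (\<forall>a\<in>carrier B. \<forall>b\<in>carrier B. D (m a b) = l (T a) (D b) + r (D a) (S b))"


subsection \<open>Iterated duals\<close>

text \<open>\<open>is_dual E F p\<close>: via \<open>p f x = \<langle>f, x\<rangle>\<close>, \<open>F\<close> is the Banach space of all bounded linear
  functionals on \<open>E\<close> with the operator norm.\<close>

definition is_dual ::
  "('k::real_normed_field, 'u::ab_group_add) nspace \<Rightarrow> ('k, 'v::ab_group_add) nspace \<Rightarrow>
   ('v \<Rightarrow> 'u \<Rightarrow> 'k) \<Rightarrow> bool" where
  "is_dual E F p \<longleftrightarrow>
     normed_space F \<and> bilinear_map F E scalars p \<and>
     (\<forall>f\<in>carrier F. bounded_linear_map E scalars (p f)) \<and>
     (\<forall>\<phi>. bounded_linear_map E scalars \<phi> \<longrightarrow>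
        (\<exists>!f. f \<in> carrier F \<and> (\<forall>x\<in>carrier E. p f x = \<phi> x))) \<and>
     (\<forall>f\<in>carrier F. nrm F f = Sup {norm (p f x) |x. x \<in> carrier E \<and> nrm E x \<le> 1})"

text \<open>\<open>spc P k\<close> is the \<open>k\<close>-th dual and \<open>pair P k f x = \<langle>f, x\<rangle>\<close> for \<open>f\<close> in the \<open>(k+1)\<close>-st and
  \<open>x\<close> in the \<open>k\<close>-th dual.  The height \<open>N\<close> is finite because HOL cannot provide a
  type that contains all iterated duals of an arbitrary space.  For each \<open>N\<close>, the space and its
  first \<open>N\<close> duals do embed in one type, their direct sum, so quantifying over all towers of
  height \<open>N\<close> in all types covers every space.\<close>

record ('k, 'u) tower =
  spc :: "nat \<Rightarrow> ('k, 'u) nspace"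
  pair :: "nat \<Rightarrow> 'u \<Rightarrow> 'u \<Rightarrow> 'k"

definition dual_tower :: "nat \<Rightarrow> ('k::real_normed_field, 'u::ab_group_add) tower \<Rightarrow> bool" where
  "dual_tower N P \<longleftrightarrow>
     banach_space (spc P 0) \<and> (\<forall>k<N. is_dual (spc P k) (spc P (k + 1)) (pair P k))"

text \<open>The element of the \<open>(k+1)\<close>-st dual that represents the functional \<open>\<phi>\<close> on the \<open>k\<close>-th.\<close>

definition functional :: "('k, 'u) tower \<Rightarrow> nat \<Rightarrow> ('u \<Rightarrow> 'k) \<Rightarrow> 'u" where
  "functional P k \<phi> =
     (THE f. f \<in> carrier (spc P (k + 1)) \<and> (\<forall>x\<in>carrier (spc P k). pair P k f x = \<phi> x))"

definition canon :: "('k, 'u) tower \<Rightarrow> nat \<Rightarrow> 'u \<Rightarrow> 'u" where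
  "canon P k x = functional P (k + 1) (\<lambda>f. pair P k f x)"

text \<open>Adjoint of a map from the \<open>j\<close>-th level of \<open>P\<close> to the \<open>k\<close>-th level of \<open>Q\<close>.\<close>

definition adj ::
  "('k, 'u) tower \<Rightarrow> nat \<Rightarrow> ('k, 'v) tower \<Rightarrow> nat \<Rightarrow> ('u \<Rightarrow> 'v) \<Rightarrow> 'v \<Rightarrow> 'u" where
  "adj P j Q k T g = functional P j (\<lambda>x. pair Q k g (T x))"

definition second_adj ::
  "('k, 'u) tower \<Rightarrow> nat \<Rightarrow> ('k, 'v) tower \<Rightarrow> nat \<Rightarrow> ('u \<Rightarrow> 'v) \<Rightarrow> 'u \<Rightarrow> 'v" where
  "second_adj P j Q k T = adj Q (k + 1) P (j + 1) (adj P j Q k T)"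

definition sigma_top ::
  "'u set \<Rightarrow> 'v set \<Rightarrow> ('u \<Rightarrow> 'v \<Rightarrow> 'k::topological_space) \<Rightarrow> 'u topology" where
  "sigma_top E F b = topology_generated_by {{x \<in> E. b x f \<in> U} |f U. f \<in> F \<and> open U}"

text \<open>Weak topology of the \<open>k\<close>-th dual, and weak* topology of the \<open>(k+1)\<close>-st.\<close>

definition weak_top :: "('k::topological_space, 'u) tower \<Rightarrow> nat \<Rightarrow> 'u topology" where
  "weak_top P k =
     sigma_top (carrier (spc P k)) (carrier (spc P (k + 1))) (\<lambda>x f. pair P k f x)"

definition weak_star_top :: "('k::topological_space, 'u) tower \<Rightarrow> nat \<Rightarrow> 'u topology" where
  "weak_star_top P k = sigma_top (carrier (spc P (k + 1))) (carrier (spc P k)) (pair P k)"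


subsection \<open>Products and module actions on the duals\<close>

text \<open>The first Arens product on the bidual of the \<open>k\<close>-th level, on which \<open>m\<close> is the product:
  \<open>ar_1\<close> is \<open>b' b\<close>, \<open>ar_2\<close> is \<open>b'' b'\<close>.\<close>

definition ar_1 :: "('k, 'u) tower \<Rightarrow> nat \<Rightarrow> ('u \<Rightarrow> 'u \<Rightarrow> 'u) \<Rightarrow> 'u \<Rightarrow> 'u \<Rightarrow> 'u" where
  "ar_1 P k m b' b = functional P k (\<lambda>c. pair P k b' (m b c))"

definition ar_2 :: "('k, 'u) tower \<Rightarrow> nat \<Rightarrow> ('u \<Rightarrow> 'u \<Rightarrow> 'u) \<Rightarrow> 'u \<Rightarrow> 'u \<Rightarrow> 'u" where
  "ar_2 P k m b'' b' = functional P k (\<lambda>b. pair P (k + 1) b'' (ar_1 P k m b' b))"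

definition arens :: "('k, 'u) tower \<Rightarrow> nat \<Rightarrow> ('u \<Rightarrow> 'u \<Rightarrow> 'u) \<Rightarrow> 'u \<Rightarrow> 'u \<Rightarrow> 'u" where
  "arens P k m a'' b'' =
     functional P (k + 1) (\<lambda>b'. pair P (k + 1) a'' (ar_2 P k m b'' b'))"

text \<open>In \<open>Q\<close>, the dual of the level on which \<open>B\<close> acts by \<open>l\<close> and \<open>r\<close>: here \<open>\<langle>b y', y\<rangle> = \<langle>y', y b\<rangle>\<close>
  and \<open>\<langle>y' b, y\<rangle> = \<langle>y', b y\<rangle>\<close>, so the left action comes from \<open>r\<close> and the right one from \<open>l\<close>.\<close>

definition dual_left ::
  "('k, 'v) tower \<Rightarrow> nat \<Rightarrow> ('v \<Rightarrow> 'u \<Rightarrow> 'v) \<Rightarrow> 'u \<Rightarrow> 'v \<Rightarrow> 'v" where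
  "dual_left Q k r b y' = functional Q k (\<lambda>y. pair Q k y' (r y b))"

definition dual_right ::
  "('k, 'v) tower \<Rightarrow> nat \<Rightarrow> ('u \<Rightarrow> 'v \<Rightarrow> 'v) \<Rightarrow> 'v \<Rightarrow> 'u \<Rightarrow> 'v" where
  "dual_right Q k l y' b = functional Q k (\<lambda>y. pair Q k y' (l b y))"

text \<open>A net in the \<open>k\<close>-th level is represented by its image filter, which determines the limits
  along the net; every proper filter arises in this way.\<close>

definition bounded_net_to ::
  "('k::topological_space, 'u) tower \<Rightarrow> nat \<Rightarrow> 'u filter \<Rightarrow> 'u \<Rightarrow> bool" where
  "bounded_net_to P k F b'' \<longleftrightarrow>
     F \<noteq> bot \<and>
     (\<exists>C. \<forall>\<^sub>F b in F. b \<in> carrier (spc P k) \<and> nrm (spc P k) b \<le> C) \<and>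
     limitin (weak_star_top P (k + 1)) (canon P k) b'' F"

text \<open>\<open>z = lim\<^sub>x lim\<^sub>y h x y\<close>, where \<open>x\<close> runs along \<open>F\<close> and \<open>y\<close> along \<open>G\<close>.\<close>

definition iterated_limit ::
  "'c topology \<Rightarrow> ('a \<Rightarrow> 'b \<Rightarrow> 'c) \<Rightarrow> 'a filter \<Rightarrow> 'b filter \<Rightarrow> 'c \<Rightarrow> bool" where
  "iterated_limit X h F G z \<longleftrightarrow>
     (\<exists>g. (\<forall>\<^sub>F x in F. limitin X (h x) (g x) G) \<and> limitin X g z F)"

definition bidual_left ::
  "('k::topological_space, 'u) tower \<Rightarrow> ('k, 'v) tower \<Rightarrow> nat \<Rightarrow>
   ('u \<Rightarrow> 'v \<Rightarrow> 'v) \<Rightarrow> 'u \<Rightarrow> 'v \<Rightarrow> 'v" where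
  "bidual_left P Q k l b'' y'' =
     (THE z. z \<in> carrier (spc Q (k + 2)) \<and>
        (\<forall>F G. bounded_net_to P k F b'' \<and> bounded_net_to Q k G y'' \<longrightarrow>
           iterated_limit (weak_star_top Q (k + 1)) (\<lambda>b y. canon Q k (l b y)) F G z))"

definition bidual_right ::
  "('k::topological_space, 'u) tower \<Rightarrow> ('k, 'v) tower \<Rightarrow> nat \<Rightarrow>
   ('v \<Rightarrow> 'u \<Rightarrow> 'v) \<Rightarrow> 'v \<Rightarrow> 'u \<Rightarrow> 'v" where
  "bidual_right P Q k r y'' b'' =
     (THE z. z \<in> carrier (spc Q (k + 2)) \<and>
        (\<forall>F G. bounded_net_to P k F b'' \<and> bounded_net_to Q k G y'' \<longrightarrow>
           iterated_limit (weak_star_top Q (k + 1)) (\<lambda>y b. canon Q k (r y b)) G F z))"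

text \<open>The operations on the even duals; odd arguments are irrelevant.\<close>

fun alg_mult :: "('k, 'u) tower \<Rightarrow> ('u \<Rightarrow> 'u \<Rightarrow> 'u) \<Rightarrow> nat \<Rightarrow> 'u \<Rightarrow> 'u \<Rightarrow> 'u" where
  "alg_mult P m 0 = m"
| "alg_mult P m (Suc 0) = undefined"
| "alg_mult P m (Suc (Suc k)) = arens P k (alg_mult P m k)"

fun left_act ::
  "('k::topological_space, 'u) tower \<Rightarrow> ('k, 'v) tower \<Rightarrow> ('u \<Rightarrow> 'v \<Rightarrow> 'v) \<Rightarrow>
   nat \<Rightarrow> 'u \<Rightarrow> 'v \<Rightarrow> 'v" where
  "left_act P Q l 0 = l"
| "left_act P Q l (Suc 0) = undefined"
| "left_act P Q l (Suc (Suc k)) = bidual_left P Q k (left_act P Q l k)"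

fun right_act ::
  "('k::topological_space, 'u) tower \<Rightarrow> ('k, 'v) tower \<Rightarrow> ('v \<Rightarrow> 'u \<Rightarrow> 'v) \<Rightarrow>
   nat \<Rightarrow> 'v \<Rightarrow> 'u \<Rightarrow> 'v" where
  "right_act P Q r 0 = r"
| "right_act P Q r (Suc 0) = undefined"
| "right_act P Q r (Suc (Suc k)) = bidual_right P Q k (right_act P Q r k)"

end

theory Submission
  imports Defs
begin

text \<open>
  Put \<open>B\<close> for the \<open>n\<close>-th dual of the algebra, \<open>Y\<close> for the \<open>n\<close>-th dual of the module, and for a bounded
  functional \<open>\<phi>\<close> on \<open>B\<close> and \<open>a''\<close> in the bidual write \<open>lim\<^sub>a \<phi> a\<close> for \<open>\<langle>a'', \<phi>\<rangle>\<close>, the limit of \<open>\<phi>\<close> along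
  any bounded net in \<open>B\<close> that tends weak* to \<open>a''\<close> (\<open>bidual_eval\<close> below).  Against a test element \<open>w\<close> of
  the bidual of \<open>Y\<close>, the definition of the first Arens product and the derivation rule give
  \<open>\<langle>D''(a''b''), w\<rangle> = lim\<^sub>a lim\<^sub>b \<langle>w, D(ab)\<rangle> = lim\<^sub>a lim\<^sub>b \<langle>w, T(a) D(b)\<rangle> + lim\<^sub>a lim\<^sub>b \<langle>w, D(a) S(b)\<rangle>\<close>.
  Unfolding the dual right action, the second iterated limit is \<open>\<langle>D''(a'') S''(b''), w\<rangle>\<close> outright, since
  the limits come in the same order.  For the first, unfolding the dual left action at elements \<open>a\<close> of
  \<open>B\<close> gives \<open>lim\<^sub>b \<langle>w, T(a) D(b)\<rangle> = \<langle>D''(b''), w T(a)\<rangle>\<close>; to move the limit over \<open>a\<close> inside the last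
  pairing is what the weak*-to-weak continuity of \<open>a'' \<mapsto> w T''(a'')\<close> permits.  This is
  \<open>ts_derivation_second_adj\<close>, with the interchange isolated in \<open>continuous_eval_canon\<close>.

  The Arens product and both module actions on the biduals are instances of one construction, the
  triple adjoint of a bounded bilinear map (\<open>arens_ext\<close>), so boundedness at every even level is one
  induction.  The module actions are given as iterated limits along all pairs of bounded nets;
  for these to determine a value there must be such nets, which is Goldstine's theorem
  (\<open>bounded_net_exists\<close>).  The same nets turn topological continuity into the interchange of limits above.
\<close>

section \<open>Bounded linear and bilinear maps on carriers\<close>

lemma scalars_simps [simp]:
  "carrier scalars = UNIV" "scl scalars = (*)" "nrm scalars = norm"
  by (simp_all add: scalars_def)

lemma normed_space_closed:
  assumes "normed_space E"
  shows "0 \<in> carrier E"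
    and "\<And>x y. x \<in> carrier E \<Longrightarrow> y \<in> carrier E \<Longrightarrow> x + y \<in> carrier E"
    and "\<And>c x. x \<in> carrier E \<Longrightarrow> scl E c x \<in> carrier E"
proof -
  interpret vector_space "scl E" using assms by (simp add: normed_space_def)
  have *: "subspace (carrier E)" using assms by (simp add: normed_space_def)
  show "0 \<in> carrier E" using subspace_0[OF *] .
  show "\<And>x y. x \<in> carrier E \<Longrightarrow> y \<in> carrier E \<Longrightarrow> x + y \<in> carrier E" using subspace_add[OF *] .
  show "\<And>c x. x \<in> carrier E \<Longrightarrow> scl E c x \<in> carrier E" using subspace_scale[OF *] .
qed

lemma normed_space_nrm:
  assumes "normed_space E"
  shows "\<And>x. x \<in> carrier E \<Longrightarrow> 0 \<le> nrm E x"
    and "nrm E 0 = 0"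
    and "\<And>x y. x \<in> carrier E \<Longrightarrow> y \<in> carrier E \<Longrightarrow> nrm E (x + y) \<le> nrm E x + nrm E y"
    and "\<And>c x. x \<in> carrier E \<Longrightarrow> nrm E (scl E c x) = norm c * nrm E x"
    and "\<And>x. x \<in> carrier E \<Longrightarrow> nrm E x = 0 \<Longrightarrow> x = 0"
  using assms normed_space_closed(1)[OF assms] by (auto simp: normed_space_def)

lemma bounded_linear_mapI:
  assumes "\<And>x. x \<in> carrier E \<Longrightarrow> f x \<in> carrier F"
    and "\<And>x y. x \<in> carrier E \<Longrightarrow> y \<in> carrier E \<Longrightarrow> f (x + y) = f x + f y"
    and "\<And>c x. x \<in> carrier E \<Longrightarrow> f (scl E c x) = scl F c (f x)"
    and "\<And>x. x \<in> carrier E \<Longrightarrow> nrm F (f x) \<le> C * nrm E x"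
  shows "bounded_linear_map E F f"
  using assms unfolding bounded_linear_map_def linear_map_def by blast

lemma bounded_linear_mapD:
  assumes "bounded_linear_map E F f"
  shows "\<And>x. x \<in> carrier E \<Longrightarrow> f x \<in> carrier F"
    and "\<And>x y. x \<in> carrier E \<Longrightarrow> y \<in> carrier E \<Longrightarrow> f (x + y) = f x + f y"
    and "\<And>c x. x \<in> carrier E \<Longrightarrow> f (scl E c x) = scl F c (f x)"
  using assms unfolding bounded_linear_map_def linear_map_def by blast+

lemma bounded_linear_map_bound:
  assumes "bounded_linear_map E F f" "normed_space E"
  obtains C where "0 \<le> C" "\<And>x. x \<in> carrier E \<Longrightarrow> nrm F (f x) \<le> C * nrm E x"
proof -
  obtain C where C: "\<forall>x\<in>carrier E. nrm F (f x) \<le> C * nrm E x"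
    using assms(1) by (auto simp: bounded_linear_map_def)
  show thesis
  proof
    show "0 \<le> \<bar>C\<bar>" by simp
    fix x assume x: "x \<in> carrier E"
    have "C * nrm E x \<le> \<bar>C\<bar> * nrm E x"
      using normed_space_nrm(1)[OF assms(2) x] by (intro mult_right_mono) auto
    then show "nrm F (f x) \<le> \<bar>C\<bar> * nrm E x" using C x by force
  qed
qed

definition bounded_bilinear_map ::
  "('k::real_normed_field, 'u::ab_group_add) nspace \<Rightarrow> ('k, 'v::ab_group_add) nspace \<Rightarrow>
   ('k, 'w::ab_group_add) nspace \<Rightarrow> ('u \<Rightarrow> 'v \<Rightarrow> 'w) \<Rightarrow> bool" where
  "bounded_bilinear_map E F G h \<longleftrightarrow> bilinear_map E F G h \<and>
     (\<exists>K\<ge>0. \<forall>x\<in>carrier E. \<forall>y\<in>carrier F. nrm G (h x y) \<le> K * nrm E x * nrm F y)"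

lemma bounded_bilinear_mapI:
  assumes "\<And>x y. x \<in> carrier E \<Longrightarrow> y \<in> carrier F \<Longrightarrow> h x y \<in> carrier G"
    and "\<And>x x' y. x \<in> carrier E \<Longrightarrow> x' \<in> carrier E \<Longrightarrow> y \<in> carrier F \<Longrightarrow> h (x + x') y = h x y + h x' y"
    and "\<And>c x y. x \<in> carrier E \<Longrightarrow> y \<in> carrier F \<Longrightarrow> h (scl E c x) y = scl G c (h x y)"
    and "\<And>x y y'. x \<in> carrier E \<Longrightarrow> y \<in> carrier F \<Longrightarrow> y' \<in> carrier F \<Longrightarrow> h x (y + y') = h x y + h x y'"
    and "\<And>c x y. x \<in> carrier E \<Longrightarrow> y \<in> carrier F \<Longrightarrow> h x (scl F c y) = scl G c (h x y)"
    and "\<And>x y. x \<in> carrier E \<Longrightarrow> y \<in> carrier F \<Longrightarrow> nrm G (h x y) \<le> K * nrm E x * nrm F y"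
    and "0 \<le> K"
  shows "bounded_bilinear_map E F G h"
  using assms unfolding bounded_bilinear_map_def bilinear_map_def linear_map_def by blast

lemma bounded_bilinear_mapD:
  assumes "bounded_bilinear_map E F G h"
  shows "\<And>x y. x \<in> carrier E \<Longrightarrow> y \<in> carrier F \<Longrightarrow> h x y \<in> carrier G"
    and "\<And>x x' y. x \<in> carrier E \<Longrightarrow> x' \<in> carrier E \<Longrightarrow> y \<in> carrier F \<Longrightarrow> h (x + x') y = h x y + h x' y"
    and "\<And>c x y. x \<in> carrier E \<Longrightarrow> y \<in> carrier F \<Longrightarrow> h (scl E c x) y = scl G c (h x y)"
    and "\<And>x y y'. x \<in> carrier E \<Longrightarrow> y \<in> carrier F \<Longrightarrow> y' \<in> carrier F \<Longrightarrow> h x (y + y') = h x y + h x y'"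
    and "\<And>c x y. x \<in> carrier E \<Longrightarrow> y \<in> carrier F \<Longrightarrow> h x (scl F c y) = scl G c (h x y)"
  using assms unfolding bounded_bilinear_map_def bilinear_map_def linear_map_def by blast+

lemma bounded_bilinear_map_bound:
  assumes "bounded_bilinear_map E F G h"
  obtains K where "0 \<le> K"
    "\<And>x y. x \<in> carrier E \<Longrightarrow> y \<in> carrier F \<Longrightarrow> nrm G (h x y) \<le> K * nrm E x * nrm F y"
  using assms unfolding bounded_bilinear_map_def by blast

lemma bounded_bilinear_map_flip:
  assumes "bounded_bilinear_map E F G h"
  shows "bounded_bilinear_map F E G (\<lambda>y x. h x y)"
proof -
  obtain K where K: "0 \<le> K"
    "\<And>x y. x \<in> carrier E \<Longrightarrow> y \<in> carrier F \<Longrightarrow> nrm G (h x y) \<le> K * nrm E x * nrm F y"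
    by (rule bounded_bilinear_map_bound[OF assms]) blast
  show ?thesis
    by (rule bounded_bilinear_mapI[where K = K])
      (use bounded_bilinear_mapD[OF assms] K in \<open>auto simp: mult_ac\<close>)
qed

lemma bounded_bilinear_map_section:
  assumes "bounded_bilinear_map E F G h" "x \<in> carrier E"
  shows "bounded_linear_map F G (h x)"
proof -
  obtain K where K: "0 \<le> K"
    "\<And>x y. x \<in> carrier E \<Longrightarrow> y \<in> carrier F \<Longrightarrow> nrm G (h x y) \<le> K * nrm E x * nrm F y"
    by (rule bounded_bilinear_map_bound[OF assms(1)]) blast
  show ?thesis
    by (rule bounded_linear_mapI[where C = "K * nrm E x"])
      (use bounded_bilinear_mapD[OF assms(1)] assms(2) K in auto)
qed

lemma bounded_linear_map_compose:
  assumes "bounded_linear_map E F f" "bounded_linear_map F G g"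
    "normed_space E" "normed_space F"
  shows "bounded_linear_map E G (\<lambda>x. g (f x))"
proof -
  obtain C where C: "0 \<le> C" "\<And>x. x \<in> carrier E \<Longrightarrow> nrm F (f x) \<le> C * nrm E x"
    by (rule bounded_linear_map_bound[OF assms(1,3)]) blast
  obtain C' where C': "0 \<le> C'" "\<And>x. x \<in> carrier F \<Longrightarrow> nrm G (g x) \<le> C' * nrm F x"
    by (rule bounded_linear_map_bound[OF assms(2,4)]) blast
  note f = bounded_linear_mapD[OF assms(1)] and g = bounded_linear_mapD[OF assms(2)]
  show ?thesis
  proof (rule bounded_linear_mapI[where C = "C' * C"])
    fix x assume x: "x \<in> carrier E"
    have "nrm G (g (f x)) \<le> C' * nrm F (f x)" using C'(2) f(1) x by blast
    also have "\<dots> \<le> C' * (C * nrm E x)" using C(2)[OF x] C'(1) by (rule mult_left_mono)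
    finally show "nrm G (g (f x)) \<le> C' * C * nrm E x" by (simp add: mult_ac)
  qed (use f g in auto)
qed

lemma bounded_bilinear_map_compose:
  assumes "bounded_bilinear_map E F G h" "bounded_linear_map E' E f" "bounded_linear_map F' F g"
    "normed_space E'" "normed_space F'" "normed_space E" "normed_space F"
  shows "bounded_bilinear_map E' F' G (\<lambda>x y. h (f x) (g y))"
proof -
  obtain K where K: "0 \<le> K"
    "\<And>x y. x \<in> carrier E \<Longrightarrow> y \<in> carrier F \<Longrightarrow> nrm G (h x y) \<le> K * nrm E x * nrm F y"
    by (rule bounded_bilinear_map_bound[OF assms(1)]) blast
  obtain C where C: "0 \<le> C" "\<And>x. x \<in> carrier E' \<Longrightarrow> nrm E (f x) \<le> C * nrm E' x"
    by (rule bounded_linear_map_bound[OF assms(2,4)]) blast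
  obtain C' where C': "0 \<le> C'" "\<And>x. x \<in> carrier F' \<Longrightarrow> nrm F (g x) \<le> C' * nrm F' x"
    by (rule bounded_linear_map_bound[OF assms(3,5)]) blast
  note h = bounded_bilinear_mapD[OF assms(1)]
  note f = bounded_linear_mapD[OF assms(2)] and g = bounded_linear_mapD[OF assms(3)]
  show ?thesis
  proof (rule bounded_bilinear_mapI[where K = "K * (C * C')"])
    fix x y assume x: "x \<in> carrier E'" and y: "y \<in> carrier F'"
    have "nrm G (h (f x) (g y)) \<le> K * (nrm E (f x) * nrm F (g y))"
      using K(2) f(1) g(1) x y by (simp add: mult.assoc)
    also have "\<dots> \<le> K * ((C * nrm E' x) * (C' * nrm F' y))"
      using C C' K(1) x y f(1) g(1) normed_space_nrm(1)[OF assms(4)] normed_space_nrm(1)[OF assms(5)]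
        normed_space_nrm(1)[OF assms(6)] normed_space_nrm(1)[OF assms(7)]
      by (intro mult_left_mono mult_mono mult_nonneg_nonneg) auto
    finally show "nrm G (h (f x) (g y)) \<le> K * (C * C') * nrm E' x * nrm F' y"
      by (simp add: mult_ac)
  qed (use f g h C C' K in auto)
qed

lemma bounded_bilinear_map_postcompose:
  assumes "bounded_bilinear_map E F G h" "bounded_linear_map G H f" "normed_space G"
  shows "bounded_bilinear_map E F H (\<lambda>x y. f (h x y))"
proof -
  obtain K where K: "0 \<le> K"
    "\<And>x y. x \<in> carrier E \<Longrightarrow> y \<in> carrier F \<Longrightarrow> nrm G (h x y) \<le> K * nrm E x * nrm F y"
    by (rule bounded_bilinear_map_bound[OF assms(1)]) blast
  obtain C where C: "0 \<le> C" "\<And>x. x \<in> carrier G \<Longrightarrow> nrm H (f x) \<le> C * nrm G x"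
    by (rule bounded_linear_map_bound[OF assms(2,3)]) blast
  note h = bounded_bilinear_mapD[OF assms(1)] and f = bounded_linear_mapD[OF assms(2)]
  show ?thesis
  proof (rule bounded_bilinear_mapI[where K = "C * K"])
    fix x y assume x: "x \<in> carrier E" and y: "y \<in> carrier F"
    have "nrm H (f (h x y)) \<le> C * nrm G (h x y)" using C(2) h(1) x y by blast
    also have "\<dots> \<le> C * (K * nrm E x * nrm F y)" using K(2)[OF x y] C(1) by (rule mult_left_mono)
    finally show "nrm H (f (h x y)) \<le> C * K * nrm E x * nrm F y" by (simp add: mult_ac)
  qed (use f h C K in auto)
qed


section \<open>Functionals and the bidual\<close>

definition dual_step :: "('k::real_normed_field, 'u::ab_group_add) tower \<Rightarrow> nat \<Rightarrow> bool" where
  "dual_step P k \<longleftrightarrow>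
     normed_space (spc P k) \<and> is_dual (spc P k) (spc P (Suc k)) (pair P k)"

lemma dual_tower_step:
  assumes "dual_tower N P" "k < N"
  shows "dual_step P k"
proof -
  have "normed_space (spc P k)"
  proof (cases k)
    case 0
    then show ?thesis using assms by (auto simp: dual_tower_def banach_space_def)
  next
    case (Suc j)
    then have "is_dual (spc P j) (spc P (j + 1)) (pair P j)"
      using assms by (auto simp: dual_tower_def)
    then show ?thesis by (simp add: is_dual_def Suc)
  qed
  then show ?thesis using assms by (auto simp: dual_tower_def dual_step_def)
qed

context
  fixes P :: "('k::real_normed_field, 'u::ab_group_add) tower" and k :: nat
  assumes step: "dual_step P k"
begin

lemma dual_step_normed: "normed_space (spc P k)" "normed_space (spc P (Suc k))"
  using step by (auto simp: dual_step_def is_dual_def)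

lemma pair_bilinear:
  "\<And>f g x. f \<in> carrier (spc P (Suc k)) \<Longrightarrow> g \<in> carrier (spc P (Suc k)) \<Longrightarrow>
     x \<in> carrier (spc P k) \<Longrightarrow> pair P k (f + g) x = pair P k f x + pair P k g x"
  "\<And>f c x. f \<in> carrier (spc P (Suc k)) \<Longrightarrow>
     x \<in> carrier (spc P k) \<Longrightarrow> pair P k (scl (spc P (Suc k)) c f) x = c * pair P k f x"
  "\<And>f x y. f \<in> carrier (spc P (Suc k)) \<Longrightarrow> x \<in> carrier (spc P k) \<Longrightarrow>
     y \<in> carrier (spc P k) \<Longrightarrow> pair P k f (x + y) = pair P k f x + pair P k f y"
  "\<And>f c x. f \<in> carrier (spc P (Suc k)) \<Longrightarrow>
     x \<in> carrier (spc P k) \<Longrightarrow> pair P k f (scl (spc P k) c x) = c * pair P k f x"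
  using step by (auto simp: dual_step_def is_dual_def bilinear_map_def linear_map_def)

lemma bounded_pair: "f \<in> carrier (spc P (Suc k)) \<Longrightarrow> bounded_linear_map (spc P k) scalars (pair P k f)"
  using step by (auto simp: dual_step_def is_dual_def)

lemma dual_nrm_le:
  assumes f: "f \<in> carrier (spc P (Suc k))"
    and le: "\<And>x. x \<in> carrier (spc P k) \<Longrightarrow> nrm (spc P k) x \<le> 1 \<Longrightarrow> norm (pair P k f x) \<le> C"
  shows "nrm (spc P (Suc k)) f \<le> C"
proof -
  have "nrm (spc P (Suc k)) f =
      Sup {norm (pair P k f x) |x. x \<in> carrier (spc P k) \<and> nrm (spc P k) x \<le> 1}"
    using step f by (auto simp: dual_step_def is_dual_def)
  also have "\<dots> \<le> C"
  proof (rule cSup_least)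
    have "0 \<in> carrier (spc P k) \<and> nrm (spc P k) 0 \<le> 1"
      using normed_space_closed(1)[OF dual_step_normed(1)] normed_space_nrm(2)[OF dual_step_normed(1)]
      by simp
    then show "{norm (pair P k f x) |x. x \<in> carrier (spc P k) \<and> nrm (spc P k) x \<le> 1} \<noteq> {}"
      by blast
  qed (use le in auto)
  finally show ?thesis .
qed

lemma norm_pair_le:
  assumes f: "f \<in> carrier (spc P (Suc k))" and x: "x \<in> carrier (spc P k)"
  shows "norm (pair P k f x) \<le> nrm (spc P (Suc k)) f * nrm (spc P k) x"
proof -
  note E = dual_step_normed(1)
  obtain C where C: "0 \<le> C" "\<And>x. x \<in> carrier (spc P k) \<Longrightarrow> norm (pair P k f x) \<le> C * nrm (spc P k) x"
    using bounded_linear_map_bound[OF bounded_pair[OF f] E] by auto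
  let ?S = "{norm (pair P k f x) |x. x \<in> carrier (spc P k) \<and> nrm (spc P k) x \<le> 1}"
  have bdd: "bdd_above ?S"
  proof (rule bdd_aboveI)
    fix s assume "s \<in> ?S"
    then obtain y where y: "y \<in> carrier (spc P k)" "nrm (spc P k) y \<le> 1" "s = norm (pair P k f y)"
      by auto
    have "s \<le> C * nrm (spc P k) y" using C(2) y by simp
    also have "\<dots> \<le> C * 1" using C(1) y(2) by (intro mult_left_mono) auto
    finally show "s \<le> C" by simp
  qed
  have sup: "nrm (spc P (Suc k)) f = Sup ?S"
    using step f by (auto simp: dual_step_def is_dual_def)
  show ?thesis
  proof (cases "nrm (spc P k) x = 0")
    case True
    then show ?thesis using C(2)[OF x] by simp
  next
    case False
    define c :: 'k where "c = inverse (of_real (nrm (spc P k) x))"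
    have pos: "0 < nrm (spc P k) x" using False normed_space_nrm(1)[OF E x] by simp
    have nc: "norm c = inverse (nrm (spc P k) x)"
      using pos by (simp add: c_def norm_inverse)
    have "norm (pair P k f (scl (spc P k) c x)) \<in> ?S"
      using normed_space_closed(3)[OF E x, of c] normed_space_nrm(4)[OF E x, of c] pos nc
      by (auto intro!: exI[of _ "scl (spc P k) c x"])
    then have "norm (pair P k f (scl (spc P k) c x)) \<le> nrm (spc P (Suc k)) f"
      unfolding sup by (rule cSup_upper[OF _ bdd])
    then show ?thesis
      using pos pair_bilinear(4)[OF f x, of c] nc by (simp add: norm_mult field_simps)
  qed
qed

lemma dual_eqI:
  assumes "f \<in> carrier (spc P (Suc k))" "g \<in> carrier (spc P (Suc k))"
    and "\<And>x. x \<in> carrier (spc P k) \<Longrightarrow> pair P k f x = pair P k g x"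
  shows "f = g"
proof -
  have "\<exists>!h. h \<in> carrier (spc P (Suc k)) \<and> (\<forall>x\<in>carrier (spc P k). pair P k h x = pair P k g x)"
    using step bounded_pair[OF assms(2)] by (auto simp: dual_step_def is_dual_def)
  then show ?thesis using assms by blast
qed

lemma functional:
  assumes "bounded_linear_map (spc P k) scalars \<phi>"
  shows functional_closed: "functional P k \<phi> \<in> carrier (spc P (Suc k))"
    and pair_functional: "\<And>x. x \<in> carrier (spc P k) \<Longrightarrow> pair P k (functional P k \<phi>) x = \<phi> x"
proof -
  have "\<exists>!h. h \<in> carrier (spc P (Suc k)) \<and> (\<forall>x\<in>carrier (spc P k). pair P k h x = \<phi> x)"
    using step assms by (auto simp: dual_step_def is_dual_def)
  from theI'[OF this]
  show "functional P k \<phi> \<in> carrier (spc P (Suc k))"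
    "\<And>x. x \<in> carrier (spc P k) \<Longrightarrow> pair P k (functional P k \<phi>) x = \<phi> x"
    by (auto simp: functional_def)
qed

lemma functional_pair: "f \<in> carrier (spc P (Suc k)) \<Longrightarrow> functional P k (pair P k f) = f"
  by (rule dual_eqI) (simp_all add: functional bounded_pair)

lemma bounded_bilinear_pair: "bounded_bilinear_map (spc P (Suc k)) (spc P k) scalars (pair P k)"
  by (rule bounded_bilinear_mapI[where K = 1]) (auto simp: pair_bilinear norm_pair_le)

end

lemma functional_cong:
  "(\<And>x. x \<in> carrier (spc P k) \<Longrightarrow> \<phi> x = \<psi> x) \<Longrightarrow> functional P k \<phi> = functional P k \<psi>"
  by (simp add: functional_def cong: conj_cong)

lemma canon:
  assumes "dual_step P k" "dual_step P (Suc k)" "x \<in> carrier (spc P k)"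
  shows canon_closed: "canon P k x \<in> carrier (spc P (Suc (Suc k)))"
    and pair_canon: "\<And>f. f \<in> carrier (spc P (Suc k)) \<Longrightarrow> pair P (Suc k) (canon P k x) f = pair P k f x"
  using functional[OF assms(2) bounded_bilinear_map_section
    [OF bounded_bilinear_map_flip[OF bounded_bilinear_pair[OF assms(1)]] assms(3)]]
  by (auto simp: canon_def)

text \<open>Thinking of \<open>x''\<close> as a weak* limit of elements \<open>x\<close>, this is the limit of \<open>\<phi> x\<close>.\<close>

definition bidual_eval ::
  "('k, 'u) tower \<Rightarrow> nat \<Rightarrow> 'u \<Rightarrow> ('u \<Rightarrow> 'k) \<Rightarrow> 'k" where
  "bidual_eval P k x'' \<phi> = pair P (Suc k) x'' (functional P k \<phi>)"

lemma bidual_eval_cong: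
  "(\<And>x. x \<in> carrier (spc P k) \<Longrightarrow> \<phi> x = \<psi> x) \<Longrightarrow> bidual_eval P k x'' \<phi> = bidual_eval P k x'' \<psi>"
  by (simp add: bidual_eval_def cong: functional_cong)

context
  fixes P :: "('k::real_normed_field, 'u::ab_group_add) tower" and k :: nat
  assumes step: "dual_step P k" "dual_step P (Suc k)"
begin

lemma bidual_eval_canon:
  "x \<in> carrier (spc P k) \<Longrightarrow> bounded_linear_map (spc P k) scalars \<phi> \<Longrightarrow>
    bidual_eval P k (canon P k x) \<phi> = \<phi> x"
  by (simp add: bidual_eval_def pair_canon step functional)

lemma bidual_eval_add_left:
  assumes "x \<in> carrier (spc P (Suc (Suc k)))" "y \<in> carrier (spc P (Suc (Suc k)))"
    "bounded_linear_map (spc P k) scalars \<phi>"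
  shows "bidual_eval P k (x + y) \<phi> = bidual_eval P k x \<phi> + bidual_eval P k y \<phi>"
  using assms by (simp add: bidual_eval_def functional step pair_bilinear)

lemma bidual_eval_scale_left:
  assumes "x \<in> carrier (spc P (Suc (Suc k)))" "bounded_linear_map (spc P k) scalars \<phi>"
  shows "bidual_eval P k (scl (spc P (Suc (Suc k))) c x) \<phi> = c * bidual_eval P k x \<phi>"
  using assms by (simp add: bidual_eval_def functional step pair_bilinear)

lemma bidual_eval_add:
  assumes "x \<in> carrier (spc P (Suc (Suc k)))"
    and \<phi>: "bounded_linear_map (spc P k) scalars \<phi>" and \<psi>: "bounded_linear_map (spc P k) scalars \<psi>"
  shows "bidual_eval P k x (\<lambda>v. \<phi> v + \<psi> v) = bidual_eval P k x \<phi> + bidual_eval P k x \<psi>"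
proof -
  have "functional P k (\<lambda>v. \<phi> v + \<psi> v) = functional P k \<phi> + functional P k \<psi>"
    (is "_ = ?s")
  proof -
    have s: "?s \<in> carrier (spc P (Suc k))"
      using normed_space_closed(2)[OF dual_step_normed(2)[OF step(1)]] functional(1)[OF step(1)] \<phi> \<psi>
      by blast
    have "functional P k (\<lambda>v. \<phi> v + \<psi> v) = functional P k (pair P k ?s)"
      by (rule functional_cong) (simp add: pair_bilinear functional step \<phi> \<psi>)
    then show ?thesis using functional_pair[OF step(1) s] by simp
  qed
  then show ?thesis
    using assms by (simp add: bidual_eval_def pair_bilinear step functional)
qed

lemma bidual_eval_scale:
  assumes "x \<in> carrier (spc P (Suc (Suc k)))"
    and \<phi>: "bounded_linear_map (spc P k) scalars \<phi>"
  shows "bidual_eval P k x (\<lambda>v. c * \<phi> v) = c * bidual_eval P k x \<phi>"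
proof -
  have "functional P k (\<lambda>v. c * \<phi> v) = scl (spc P (Suc k)) c (functional P k \<phi>)"
    (is "_ = ?s")
  proof -
    have s: "?s \<in> carrier (spc P (Suc k))"
      using normed_space_closed(3)[OF dual_step_normed(2)[OF step(1)]] functional(1)[OF step(1)] \<phi>
      by blast
    have "functional P k (\<lambda>v. c * \<phi> v) = functional P k (pair P k ?s)"
      by (rule functional_cong) (simp add: pair_bilinear functional step \<phi>)
    then show ?thesis using functional_pair[OF step(1) s] by simp
  qed
  then show ?thesis
    using assms by (simp add: bidual_eval_def pair_bilinear step functional)
qed

lemma norm_bidual_eval_le:
  assumes x: "x \<in> carrier (spc P (Suc (Suc k)))"
    and \<phi>: "bounded_linear_map (spc P k) scalars \<phi>" 
    and C: "0 \<le> C" "\<And>v. v \<in> carrier (spc P k) \<Longrightarrow> norm (\<phi> v) \<le> C * nrm (spc P k) v"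
  shows "norm (bidual_eval P k x \<phi>) \<le> nrm (spc P (Suc (Suc k))) x * C"
proof -
  note f = functional[OF step(1) \<phi>]
  have "nrm (spc P (Suc k)) (functional P k \<phi>) \<le> C"
  proof (rule dual_nrm_le[OF step(1) f(1)])
    fix v assume v: "v \<in> carrier (spc P k)" "nrm (spc P k) v \<le> 1"
    have "norm (\<phi> v) \<le> C * nrm (spc P k) v" using C v by blast
    also have "\<dots> \<le> C * 1" using C v by (intro mult_left_mono)
    finally show "norm (pair P k (functional P k \<phi>) v) \<le> C" using f v by simp
  qed
  then have "nrm (spc P (Suc (Suc k))) x * nrm (spc P (Suc k)) (functional P k \<phi>)
      \<le> nrm (spc P (Suc (Suc k))) x * C"
    using normed_space_nrm(1)[OF dual_step_normed(2)[OF step(2)] x] by (rule mult_left_mono)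
  then show ?thesis
    using norm_pair_le[OF step(2) x f(1)] by (simp add: bidual_eval_def)
qed

end

text \<open>Iterated limits are taken one at a time: after the inner one a bounded bilinear form remains, whose
  section at \<open>y''\<close> is a bounded functional, so that the outer one makes sense.\<close>

lemma bounded_bilinear_bidual_eval:
  assumes step: "dual_step Q k" "dual_step Q (Suc k)"
    and E: "normed_space E"
    and h: "bounded_bilinear_map E (spc Q k) scalars h"
  shows "bounded_bilinear_map E (spc Q (Suc (Suc k))) scalars (\<lambda>x y''. bidual_eval Q k y'' (h x))"
proof -
  obtain K where K: "0 \<le> K"
    "\<And>x y. x \<in> carrier E \<Longrightarrow> y \<in> carrier (spc Q k) \<Longrightarrow> norm (h x y) \<le> K * nrm E x * nrm (spc Q k) y"
    using bounded_bilinear_map_bound[OF h] by auto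
  note hD = bounded_bilinear_mapD[OF h]
  note sec = bounded_bilinear_map_section[OF h]
  show ?thesis
  proof (rule bounded_bilinear_mapI[where K = K])
    fix x x' y assume *: "x \<in> carrier E" "x' \<in> carrier E" "y \<in> carrier (spc Q (Suc (Suc k)))"
    have "bidual_eval Q k y (h (x + x')) = bidual_eval Q k y (\<lambda>v. h x v + h x' v)"
      by (rule bidual_eval_cong) (use hD * in simp)
    then show "bidual_eval Q k y (h (x + x')) = bidual_eval Q k y (h x) + bidual_eval Q k y (h x')"
      using bidual_eval_add[OF step] sec * by simp
  next
    fix c x y assume *: "x \<in> carrier E" "y \<in> carrier (spc Q (Suc (Suc k)))"
    have "bidual_eval Q k y (h (scl E c x)) = bidual_eval Q k y (\<lambda>v. c * h x v)"
      by (rule bidual_eval_cong) (use hD * in simp)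
    then show "bidual_eval Q k y (h (scl E c x)) = scl scalars c (bidual_eval Q k y (h x))"
      using bidual_eval_scale[OF step] sec * by simp
  next
    fix x y assume *: "x \<in> carrier E" "y \<in> carrier (spc Q (Suc (Suc k)))"
    have "norm (bidual_eval Q k y (h x)) \<le> nrm (spc Q (Suc (Suc k))) y * (K * nrm E x)"
      by (rule norm_bidual_eval_le[OF step])
        (use * sec K normed_space_nrm(1)[OF E] in auto)
    then show "nrm scalars (bidual_eval Q k y (h x)) \<le> K * nrm E x * nrm (spc Q (Suc (Suc k))) y"
      by (simp add: mult_ac)
  qed (use bidual_eval_add_left[OF step] bidual_eval_scale_left[OF step] sec K in auto)
qed

lemma bounded_linear_bidual_eval:
  assumes "dual_step Q k" "dual_step Q (Suc k)" "normed_space E"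
    "bounded_bilinear_map E (spc Q k) scalars h" "y'' \<in> carrier (spc Q (Suc (Suc k)))"
  shows "bounded_linear_map E scalars (\<lambda>x. bidual_eval Q k y'' (h x))"
  using bounded_bilinear_map_section[OF bounded_bilinear_map_flip
      [OF bounded_bilinear_bidual_eval[OF assms(1-4)]] assms(5)] .

text \<open>The triple adjoint and the dual module actions both arise by currying a bounded trilinear
  form.\<close>

lemma bounded_bilinear_functional:
  assumes step: "dual_step R j"
    and E: "normed_space E" and F: "normed_space F"
    and t1: "\<And>x z. x \<in> carrier E \<Longrightarrow> z \<in> carrier (spc R j) \<Longrightarrow> linear_map F scalars (\<lambda>y. t x y z)"
    and t2: "\<And>y z. y \<in> carrier F \<Longrightarrow> z \<in> carrier (spc R j) \<Longrightarrow> linear_map E scalars (\<lambda>x. t x y z)"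
    and t3: "\<And>x y. x \<in> carrier E \<Longrightarrow> y \<in> carrier F \<Longrightarrow> linear_map (spc R j) scalars (t x y)"
    and K: "0 \<le> K" "\<And>x y z. x \<in> carrier E \<Longrightarrow> y \<in> carrier F \<Longrightarrow> z \<in> carrier (spc R j) \<Longrightarrow>
      norm (t x y z) \<le> K * nrm E x * nrm F y * nrm (spc R j) z"
  shows "bounded_bilinear_map E F (spc R (Suc j)) (\<lambda>x y. functional R j (t x y))"
    and "\<And>x y. x \<in> carrier E \<Longrightarrow> y \<in> carrier F \<Longrightarrow> bounded_linear_map (spc R j) scalars (t x y)"
proof -
  show b: "\<And>x y. x \<in> carrier E \<Longrightarrow> y \<in> carrier F \<Longrightarrow> bounded_linear_map (spc R j) scalars (t x y)"
    unfolding bounded_linear_map_def using t3 K(2) by fastforce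
  note f = functional[OF step b]
  note cl = normed_space_closed[OF dual_step_normed(2)[OF step]]
  note clE = normed_space_closed[OF E] and clF = normed_space_closed[OF F]
  show "bounded_bilinear_map E F (spc R (Suc j)) (\<lambda>x y. functional R j (t x y))"
  proof (rule bounded_bilinear_mapI[where K = K])
    fix x y assume xy: "x \<in> carrier E" "y \<in> carrier F"
    show "nrm (spc R (Suc j)) (functional R j (t x y)) \<le> K * nrm E x * nrm F y"
    proof (rule dual_nrm_le[OF step f(1)[OF xy]])
      fix z assume z: "z \<in> carrier (spc R j)" "nrm (spc R j) z \<le> 1"
      have "norm (t x y z) \<le> K * nrm E x * nrm F y * nrm (spc R j) z" using K xy z by blast
      also have "\<dots> \<le> K * nrm E x * nrm F y * 1"
        using K xy z normed_space_nrm(1)[OF E] normed_space_nrm(1)[OF F] by (intro mult_left_mono mult_nonneg_nonneg)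
      finally show "norm (pair R j (functional R j (t x y)) z) \<le> K * nrm E x * nrm F y"
        using f xy z by simp
    qed
  next
    fix x x' y assume *: "x \<in> carrier E" "x' \<in> carrier E" "y \<in> carrier F"
    show "functional R j (t (x + x') y) = functional R j (t x y) + functional R j (t x' y)"
      by (rule dual_eqI[OF step])
        (use * f cl clE t2 pair_bilinear[OF step] in \<open>auto simp: linear_map_def\<close>)
  next
    fix c x y assume *: "x \<in> carrier E" "y \<in> carrier F"
    show "functional R j (t (scl E c x) y) = scl (spc R (Suc j)) c (functional R j (t x y))"
      by (rule dual_eqI[OF step])
        (use * f cl clE t2 pair_bilinear[OF step] in \<open>auto simp: linear_map_def\<close>)
  next
    fix x y y' assume *: "x \<in> carrier E" "y \<in> carrier F" "y' \<in> carrier F"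
    show "functional R j (t x (y + y')) = functional R j (t x y) + functional R j (t x y')"
      by (rule dual_eqI[OF step])
        (use * f cl clF t1 pair_bilinear[OF step] in \<open>auto simp: linear_map_def\<close>)
  next
    fix c x y assume *: "x \<in> carrier E" "y \<in> carrier F"
    show "functional R j (t x (scl F c y)) = scl (spc R (Suc j)) c (functional R j (t x y))"
      by (rule dual_eqI[OF step])
        (use * f cl clF t1 pair_bilinear[OF step] in \<open>auto simp: linear_map_def\<close>)
  qed (use f K in auto)
qed


section \<open>Weak* approximation by bounded nets\<close>

lemma topspace_sigma_top: "C \<noteq> {} \<Longrightarrow> topspace (sigma_top E C b) = E"
  unfolding sigma_top_def topology_generated_by_topspace using open_UNIV by blast

lemma limitin_sigma_top:
  assumes "C \<noteq> {}"
  shows "limitin (sigma_top E C b) g z F \<longleftrightarrow>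
    z \<in> E \<and> (\<forall>\<^sub>F x in F. g x \<in> E) \<and> (\<forall>f\<in>C. ((\<lambda>x. b (g x) f) \<longlongrightarrow> b z f) F)"
    (is "?L \<longleftrightarrow> ?R")
proof -
  let ?B = "{{x \<in> E. b x f \<in> U} |f U. f \<in> C \<and> open U}"
  note top = topspace_sigma_top[OF assms, of E b]
  have basis: "openin (sigma_top E C b) {x \<in> E. b x f \<in> U}" if "f \<in> C" "open U" for f U
    unfolding sigma_top_def openin_topology_generated_by_iff
    by (rule generate_topology_on.Basis) (use that in blast)
  show ?thesis
  proof
    assume L: ?L
    have "\<forall>\<^sub>F x in F. g x \<in> E" using L top by (metis limitin_def openin_topspace)
    moreover have "((\<lambda>x. b (g x) f) \<longlongrightarrow> b z f) F" if f: "f \<in> C" for f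
    proof (rule topological_tendstoI)
      fix U assume U: "open U" "b z f \<in> U"
      then have "\<forall>\<^sub>F x in F. g x \<in> {x \<in> E. b x f \<in> U}"
        using L basis[OF f U(1)] top by (auto simp: limitin_def)
      then show "\<forall>\<^sub>F x in F. b (g x) f \<in> U" by (rule eventually_mono) auto
    qed
    ultimately show ?R using L top by (auto simp: limitin_def)
  next
    assume R: ?R
    have "\<forall>\<^sub>F x in F. g x \<in> U" if "generate_topology_on ?B U" "z \<in> U" for U
      using that
    proof (induction rule: generate_topology_on.induct)
      case (Int a b)
      then show ?case by (auto intro: eventually_conj)
    next
      case (UN K)
      then obtain k where k: "k \<in> K" "z \<in> k" by blast
      show ?case using UN.IH[OF k] by (rule eventually_mono) (use k in blast)
    next
      case (Basis s)
      then obtain f U where "f \<in> C" "open U" "s = {x \<in> E. b x f \<in> U}" by blast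
      moreover from this have "\<forall>\<^sub>F x in F. b (g x) f \<in> U"
        using R Basis by (auto intro: topological_tendstoD)
      ultimately show ?case using R by (auto elim: eventually_elim2)
    qed simp
    then show ?L
      using R top unfolding limitin_def sigma_top_def openin_topology_generated_by_iff by simp
  qed
qed

lemma carrier_nonempty: "dual_step P k \<Longrightarrow> carrier (spc P k) \<noteq> {}"
  using normed_space_closed(1) dual_step_normed(1) by blast

lemma limitin_weak_star_top:
  assumes "dual_step P k"
  shows "limitin (weak_star_top P k) g z F \<longleftrightarrow> z \<in> carrier (spc P (Suc k)) \<and>
    (\<forall>\<^sub>F x in F. g x \<in> carrier (spc P (Suc k))) \<and>
    (\<forall>f\<in>carrier (spc P k). ((\<lambda>x. pair P k (g x) f) \<longlongrightarrow> pair P k z f) F)"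
  using limitin_sigma_top[OF carrier_nonempty[OF assms]] by (simp add: weak_star_top_def)

lemma limitin_weak_top:
  assumes "dual_step P k"
  shows "limitin (weak_top P k) g z F \<longleftrightarrow> z \<in> carrier (spc P k) \<and>
    (\<forall>\<^sub>F x in F. g x \<in> carrier (spc P k)) \<and>
    (\<forall>f\<in>carrier (spc P (Suc k)). ((\<lambda>x. pair P k f (g x)) \<longlongrightarrow> pair P k f z) F)"
proof -
  have "carrier (spc P (Suc k)) \<noteq> {}"
    using normed_space_closed(1)[OF dual_step_normed(2)[OF assms]] by blast
  from limitin_sigma_top[OF this] show ?thesis by (simp add: weak_top_def)
qed

text \<open>The norm of the scalar field is multiplicative, so multiplication by \<open>v\<close> scales the inner product by
  \<open>(norm v)\<^sup>2\<close>.  Hence every real functional \<open>inner v\<close> is a fixed one composed with a scalar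
  multiplication, which turns real combinations of functionals into scalar ones.\<close>

lemma real_inner_field:
  fixes v w :: "'k::{real_normed_field, real_inner}"
  shows "inner v w = inner 1 (of_real ((norm v)\<^sup>2) / v * w)"
proof (cases "v = 0")
  case False
  have scale: "inner (c * a) (c * b) = (norm c)\<^sup>2 * inner a b" for a b c :: 'k
    unfolding dot_norm distrib_left[symmetric] norm_mult power_mult_distrib
    by (simp add: algebra_simps diff_divide_distrib)
  have "inner v w = inner (v * 1) (v * (w / v))" using False by simp
  also have "\<dots> = (norm v)\<^sup>2 * inner 1 (w / v)" by (rule scale)
  also have "\<dots> = inner 1 ((norm v)\<^sup>2 *\<^sub>R (w / v))" by simp
  finally show ?thesis by (simp add: scaleR_conv_of_real)
qed simp

context
  fixes P :: "('k::{real_normed_field, euclidean_space}, 'u::ab_group_add) tower" and k :: nat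
  assumes step: "dual_step P k" "dual_step P (Suc k)"
begin

lemma functional_combination:
  assumes "finite I" "I \<subseteq> carrier (spc P (Suc k))"
  obtains g where "g \<in> carrier (spc P (Suc k))"
    "\<And>x. x \<in> carrier (spc P k) \<Longrightarrow> pair P k g x = (\<Sum>f\<in>I. c f * pair P k f x)"
    "\<And>z. z \<in> carrier (spc P (Suc (Suc k))) \<Longrightarrow>
      pair P (Suc k) z g = (\<Sum>f\<in>I. c f * pair P (Suc k) z f)"
  using assms
proof (induction I arbitrary: thesis rule: finite_induct)
  case empty
  note cl = normed_space_closed[OF dual_step_normed(2)[OF step(1)]]
  interpret vector_space "scl (spc P (Suc k))"
    using dual_step_normed(2)[OF step(1)] by (simp add: normed_space_def)
  have "pair P k 0 x = 0" if "x \<in> carrier (spc P k)" for x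
    using pair_bilinear(2)[OF step(1) cl(1) that, of 0] by simp
  moreover have "pair P (Suc k) z 0 = 0" if "z \<in> carrier (spc P (Suc (Suc k)))" for z
    using pair_bilinear(4)[OF step(2) that cl(1), of 0] by simp
  ultimately show ?case using empty.prems(1)[of 0] cl by simp
next
  case (insert f I)
  note cl = normed_space_closed[OF dual_step_normed(2)[OF step(1)]]
  obtain g where g: "g \<in> carrier (spc P (Suc k))"
    "\<And>x. x \<in> carrier (spc P k) \<Longrightarrow> pair P k g x = (\<Sum>f\<in>I. c f * pair P k f x)"
    "\<And>z. z \<in> carrier (spc P (Suc (Suc k))) \<Longrightarrow>
      pair P (Suc k) z g = (\<Sum>f\<in>I. c f * pair P (Suc k) z f)"
    using insert.IH insert.prems(2) by blast
  have f: "f \<in> carrier (spc P (Suc k))" using insert.prems by simp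
  show ?case
    by (rule insert.prems(1)[of "scl (spc P (Suc k)) (c f) f + g"])
      (use f g cl pair_bilinear[OF step(1)] pair_bilinear[OF step(2)] insert.hyps in simp_all)
qed

text \<open>On the unit ball \<open>f\<close> takes values of norm arbitrarily close to \<open>nrm f\<close>, and scalars rotate and shrink
  them to any prescribed smaller value; the extra 1 in the radius is there because \<open>nrm f\<close> itself need not be
  attained.\<close>

lemma functional_value_attained:
  assumes z: "z \<in> carrier (spc P (Suc (Suc k)))" and f: "f \<in> carrier (spc P (Suc k))"
  obtains x where "x \<in> carrier (spc P k)" "nrm (spc P k) x \<le> nrm (spc P (Suc (Suc k))) z + 1"
    "pair P k f x = pair P (Suc k) z f"
proof -
  note E = dual_step_normed(1)[OF step(1)]
  let ?R = "nrm (spc P (Suc (Suc k))) z + 1" and ?p = "pair P (Suc k) z f"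
  have R: "?R > 0" using normed_space_nrm(1)[OF dual_step_normed(2)[OF step(2)] z] by simp
  show thesis
  proof (cases "?p = 0")
    case True
    interpret vector_space "scl (spc P k)" using E by (simp add: normed_space_def)
    note E0 = normed_space_closed(1)[OF E]
    have "pair P k f 0 = 0" using pair_bilinear(4)[OF step(1) f E0, of 0] by simp
    then show thesis using that[of 0] True E0 normed_space_nrm(2)[OF E] R by simp
  next
    case False
    have "\<exists>y\<in>carrier (spc P k). nrm (spc P k) y \<le> 1 \<and> norm (pair P k f y) > norm ?p / ?R"
    proof (rule ccontr)
      assume "\<not> ?thesis"
      then have "nrm (spc P (Suc k)) f \<le> norm ?p / ?R"
        by (intro dual_nrm_le[OF step(1) f]) force
      then have "?R * nrm (spc P (Suc k)) f \<le> norm ?p" using R by (simp add: field_simps)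
      moreover have "norm ?p \<le> (?R - 1) * nrm (spc P (Suc k)) f"
        using norm_pair_le[OF step(2) z f] by simp
      ultimately have "nrm (spc P (Suc k)) f \<le> 0" by (simp add: algebra_simps)
      then have "nrm (spc P (Suc k)) f = 0"
        using normed_space_nrm(1)[OF dual_step_normed(2)[OF step(1)] f] by simp
      then show False using norm_pair_le[OF step(2) z f] False by simp
    qed
    then obtain y where y: "y \<in> carrier (spc P k)" "nrm (spc P k) y \<le> 1"
      "norm (pair P k f y) > norm ?p / ?R" by blast
    have pos: "0 < norm (pair P k f y)"
      using y(3) R by (smt (verit) divide_nonneg_pos norm_ge_zero)
    let ?u = "?p / pair P k f y"
    have u: "norm ?u \<le> ?R" using y(3) R pos by (simp add: norm_divide field_simps)
    have "norm ?u * nrm (spc P k) y \<le> ?R * 1"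
      using u y normed_space_nrm(1)[OF E y(1)] R by (intro mult_mono) auto
    then have "nrm (spc P k) (scl (spc P k) ?u y) \<le> ?R"
      using normed_space_nrm(4)[OF E y(1)] by simp
    moreover have "pair P k f (scl (spc P k) ?u y) = ?p"
      using pair_bilinear(4)[OF step(1) f y(1)] pos by simp
    ultimately show thesis using that normed_space_closed(3)[OF E y(1)] by blast
  qed
qed

text \<open>Helly's form of Goldstine's theorem, without a separation theorem.  Let \<open>q x\<close> be the sum of the squared
  errors over \<open>I\<close>.  At any \<open>x0\<close> in the ball, the inner product with the error vector of \<open>x0\<close> is, by the
  preceding lemmas, a single functional whose bidual value is attained at some \<open>x\<close> in the ball; so the error
  vector of \<open>x\<close> is orthogonal to that of \<open>x0\<close>, and \<open>q\<close> at \<open>(1 - t) x0 + t x\<close> is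
  \<open>(1 - t)\<^sup>2 q x0 + t\<^sup>2 q x\<close>.  Small \<open>t\<close> improve on any positive infimum of \<open>q\<close>.\<close>

lemma bidual_approximation:
  assumes z: "z \<in> carrier (spc P (Suc (Suc k)))"
    and I: "finite I" "I \<subseteq> carrier (spc P (Suc k))" and \<epsilon>: "0 < \<epsilon>"
  obtains x where "x \<in> carrier (spc P k)" "nrm (spc P k) x \<le> nrm (spc P (Suc (Suc k))) z + 1"
    "\<And>f. f \<in> I \<Longrightarrow> norm (pair P k f x - pair P (Suc k) z f) < \<epsilon>"
proof -
  note E = dual_step_normed(1)[OF step(1)]
  note Ecl = normed_space_closed[OF E] and Enrm = normed_space_nrm[OF E]
  define R where "R = nrm (spc P (Suc (Suc k))) z + 1"
  have R: "R > 0" using normed_space_nrm(1)[OF dual_step_normed(2)[OF step(2)] z] by (simp add: R_def)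
  define B where "B = {x \<in> carrier (spc P k). nrm (spc P k) x \<le> R}"
  define v where "v f x = pair P k f x - pair P (Suc k) z f" for f x
  define q where "q x = (\<Sum>f\<in>I. (norm (v f x))\<^sup>2)" for x
  define M where "M = (\<Sum>f\<in>I. (nrm (spc P (Suc k)) f * R + norm (pair P (Suc k) z f))\<^sup>2)"
  have M: "M \<ge> 0" unfolding M_def by (intro sum_nonneg) simp
  have q_nonneg: "0 \<le> q x" for x unfolding q_def by (intro sum_nonneg) simp
  have q_le: "q x \<le> M" if "x \<in> B" for x
    unfolding q_def M_def
  proof (intro sum_mono power_mono)
    fix f assume "f \<in> I"
    then have f: "f \<in> carrier (spc P (Suc k))" using I by blast
    have "norm (pair P k f x) \<le> nrm (spc P (Suc k)) f * nrm (spc P k) x"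
      using norm_pair_le[OF step(1) f] that by (simp add: B_def)
    also have "\<dots> \<le> nrm (spc P (Suc k)) f * R"
      using normed_space_nrm(1)[OF dual_step_normed(2)[OF step(1)] f] that
      by (intro mult_left_mono) (auto simp: B_def)
    finally show "norm (v f x) \<le> nrm (spc P (Suc k)) f * R + norm (pair P (Suc k) z f)"
      unfolding v_def by (smt (verit) norm_triangle_ineq4)
  qed simp
  have descent: "\<exists>x1\<in>B. q x1 \<le> (1 - t)\<^sup>2 * q x0 + t\<^sup>2 * M" if x0: "x0 \<in> B" and t: "0 \<le> t" "t \<le> 1" for x0 t
  proof -
    \<comment> \<open>With these coefficients, \<open>inner 1\<close> of the combination is the inner product with the errors of \<open>x0\<close>.\<close>
    define c where "c f = of_real ((norm (v f x0))\<^sup>2) / v f x0" for f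
    obtain g where g: "g \<in> carrier (spc P (Suc k))"
      "\<And>x. x \<in> carrier (spc P k) \<Longrightarrow> pair P k g x = (\<Sum>f\<in>I. c f * pair P k f x)"
      "\<And>z. z \<in> carrier (spc P (Suc (Suc k))) \<Longrightarrow>
        pair P (Suc k) z g = (\<Sum>f\<in>I. c f * pair P (Suc k) z f)"
      by (rule functional_combination[OF I, where c = c]) blast
    obtain x where x: "x \<in> B" "pair P k g x = pair P (Suc k) z g"
      using functional_value_attained[OF z g(1)] by (auto simp: B_def R_def)
    have xE: "x \<in> carrier (spc P k)" and x0E: "x0 \<in> carrier (spc P k)"
      using x x0 by (auto simp: B_def)
    have "(\<Sum>f\<in>I. inner (v f x0) (v f x)) = inner 1 (\<Sum>f\<in>I. c f * v f x)"
      unfolding inner_sum_right c_def by (intro sum.cong refl real_inner_field)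
    also have "(\<Sum>f\<in>I. c f * v f x) = 0"
      using g(2)[OF xE] g(3)[OF z] x(2) by (simp add: v_def right_diff_distrib sum_subtractf)
    finally have orth: "(\<Sum>f\<in>I. inner (v f x0) (v f x)) = 0" by simp
    define x1 where "x1 = scl (spc P k) (of_real (1 - t)) x0 + scl (spc P k) (of_real t) x"
    have v1: "v f x1 = (1 - t) *\<^sub>R v f x0 + t *\<^sub>R v f x" if "f \<in> I" for f
    proof -
      have f: "f \<in> carrier (spc P (Suc k))" using I that by blast
      show ?thesis
        unfolding v_def x1_def scaleR_conv_of_real
        by (simp only: pair_bilinear(3,4)[OF step(1) f] Ecl xE x0E) (simp add: algebra_simps)
    qed
    have "q x1 = (\<Sum>f\<in>I. (1 - t)\<^sup>2 * (norm (v f x0))\<^sup>2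
        + 2 * t * (1 - t) * inner (v f x0) (v f x) + t\<^sup>2 * (norm (v f x))\<^sup>2)"
      unfolding q_def
    proof (intro sum.cong refl)
      fix f assume f: "f \<in> I"
      show "(norm (v f x1))\<^sup>2 = (1 - t)\<^sup>2 * (norm (v f x0))\<^sup>2
        + 2 * t * (1 - t) * inner (v f x0) (v f x) + t\<^sup>2 * (norm (v f x))\<^sup>2"
        unfolding v1[OF f] power2_norm_eq_inner
        by (simp add: inner_add_left inner_add_right inner_commute power2_eq_square algebra_simps)
    qed
    also have "\<dots> = (1 - t)\<^sup>2 * q x0 + 2 * t * (1 - t) * (\<Sum>f\<in>I. inner (v f x0) (v f x)) + t\<^sup>2 * q x"
      by (simp add: sum.distrib sum_distrib_left q_def)
    also have "\<dots> \<le> (1 - t)\<^sup>2 * q x0 + t\<^sup>2 * M"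
      using orth q_le[OF x(1)] by (simp add: mult_left_mono)
    finally have le: "q x1 \<le> (1 - t)\<^sup>2 * q x0 + t\<^sup>2 * M" .
    have "nrm (spc P k) x1 \<le> (1 - t) * nrm (spc P k) x0 + t * nrm (spc P k) x"
      unfolding x1_def
      using Enrm(3)[OF Ecl(3)[OF x0E] Ecl(3)[OF xE]] Enrm(4)[OF x0E] Enrm(4)[OF xE] t
      by (smt (verit) norm_of_real)
    also have "\<dots> \<le> (1 - t) * R + t * R"
      using x x0 t by (intro add_mono mult_left_mono) (auto simp: B_def)
    finally have "x1 \<in> B" using Ecl xE x0E by (simp add: B_def x1_def algebra_simps)
    then show ?thesis using le by blast
  qed
  have B0: "0 \<in> B" using Ecl(1) Enrm(2) R by (simp add: B_def)
  define d where "d = Inf (q ` B)"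
  have bdd: "bdd_below (q ` B)" by (rule bdd_belowI2[where m = 0]) (rule q_nonneg)
  have d_le: "d \<le> q x" if "x \<in> B" for x
    unfolding d_def using that bdd by (rule cINF_lower[rotated])
  have "d \<ge> 0" unfolding d_def using B0 q_nonneg by (intro cINF_greatest) auto
  have step_d: "d \<le> t * M" if t: "0 < t" "t \<le> 1" for t
  proof -
    have "(d - t\<^sup>2 * M) \<le> (1 - t) * q x" if x: "x \<in> B" for x
    proof -
      obtain x1 where "x1 \<in> B" "q x1 \<le> (1 - t)\<^sup>2 * q x + t\<^sup>2 * M"
        using descent[OF x, of t] t by auto
      moreover have "(1 - t)\<^sup>2 * q x \<le> (1 - t) * q x"
        using t q_nonneg[of x] by (intro mult_right_mono) (auto simp: power2_eq_square mult_left_le)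
      ultimately show ?thesis using d_le[of x1] by linarith
    qed
    have "d - t\<^sup>2 * M \<le> (1 - t) * d"
    proof (cases "t = 1")
      case True
      then show ?thesis using \<open>\<And>x. x \<in> B \<Longrightarrow> d - t\<^sup>2 * M \<le> (1 - t) * q x\<close>[OF B0] by simp
    next
      case False
      then have t1: "1 - t > 0" using t by simp
      have "(d - t\<^sup>2 * M) / (1 - t) \<le> d"
        unfolding d_def
      proof (rule cINF_greatest)
        fix x assume "x \<in> B"
        then have "d - t\<^sup>2 * M \<le> (1 - t) * q x"
          by (rule \<open>\<And>x. x \<in> B \<Longrightarrow> d - t\<^sup>2 * M \<le> (1 - t) * q x\<close>)
        then show "(Inf (q ` B) - t\<^sup>2 * M) / (1 - t) \<le> q x"
          using t1 by (simp add: d_def field_simps)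
      qed (use B0 in blast)
      then show ?thesis using t1 by (simp add: field_simps)
    qed
    then have "t * d \<le> t * (t * M)" by (simp add: algebra_simps power2_eq_square)
    then show ?thesis using t by simp
  qed
  have "d < \<epsilon>\<^sup>2"
  proof -
    define t where "t = min 1 (\<epsilon>\<^sup>2 / (2 * (M + 1)))"
    have t: "0 < t" "t \<le> 1" "t \<le> \<epsilon>\<^sup>2 / (2 * (M + 1))" using \<epsilon> M by (auto simp: t_def)
    have "d \<le> t * M" using step_d t by blast
    also have "\<dots> \<le> \<epsilon>\<^sup>2 / (2 * (M + 1)) * (M + 1)" using t M \<epsilon> by (intro mult_mono) auto
    also have "\<dots> = \<epsilon>\<^sup>2 / 2" using M by (simp add: field_simps)
    also have "\<dots> < \<epsilon>\<^sup>2" using \<epsilon> by simp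
    finally show ?thesis .
  qed
  then obtain x where x: "x \<in> B" "q x < \<epsilon>\<^sup>2"
    using cInf_lessD[of "q ` B" "\<epsilon>\<^sup>2"] B0 unfolding d_def by blast
  have "norm (v f x) < \<epsilon>" if "f \<in> I" for f
  proof -
    have "(norm (v f x))\<^sup>2 \<le> q x" unfolding q_def by (rule member_le_sum) (use that I in auto)
    then have "(norm (v f x))\<^sup>2 < \<epsilon>\<^sup>2" using x by simp
    then show ?thesis using \<epsilon> by (simp add: power2_less_imp_less)
  qed
  then show thesis using that x by (auto simp: B_def R_def v_def)
qed

text \<open>Goldstine's theorem, with the filter generated by the traces of the weak* neighbourhoods on
  a ball.\<close>

lemma bounded_net_exists:
  assumes z: "z \<in> carrier (spc P (Suc (Suc k)))"
  obtains F where "bounded_net_to P k F z"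
proof -
  let ?R = "nrm (spc P (Suc (Suc k))) z + 1"
  let ?J = "carrier (spc P (Suc k)) \<times> {0::real<..}"
  define N where "N = (\<lambda>(f, e). {x \<in> carrier (spc P k). nrm (spc P k) x \<le> ?R \<and>
    norm (pair P k f x - pair P (Suc k) z f) < e})"
  define F where "F = (INF j\<in>?J. principal (N j))"
  have "F \<noteq> bot"
    unfolding F_def
  proof (rule INF_filter_not_bot)
    fix X assume X: "X \<subseteq> ?J" "finite X"
    define e where "e = Min (insert 1 (snd ` X))"
    have e: "0 < e" "\<And>j. j \<in> X \<Longrightarrow> e \<le> snd j" using X by (auto simp: e_def)
    have fin: "finite (fst ` X)" and sub: "fst ` X \<subseteq> carrier (spc P (Suc k))" using X by auto
    obtain x where x: "x \<in> carrier (spc P k)" "nrm (spc P k) x \<le> ?R"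
      "\<And>f. f \<in> fst ` X \<Longrightarrow> norm (pair P k f x - pair P (Suc k) z f) < e"
      by (rule bidual_approximation[OF z fin sub e(1)]) blast
    have "x \<in> N j" if j: "j \<in> X" for j
      using x(1,2) less_le_trans[OF x(3)[OF imageI[OF j]] e(2)[OF j]]
      by (simp add: N_def case_prod_unfold)
    then have "x \<in> (\<Inter>j\<in>X. N j)" by blast
    then show "(INF j\<in>X. principal (N j)) \<noteq> bot"
      by (auto simp: INF_principal_finite[OF X(2)] principal_eq_bot_iff)
  qed
  have ev: "\<forall>\<^sub>F x in F. x \<in> N (f, e)" if "f \<in> carrier (spc P (Suc k))" "0 < e" for f e
    unfolding F_def by (rule eventually_INF1[of "(f, e)"]) (use that in \<open>auto simp: eventually_principal\<close>)
  \<comment> \<open>Any functional will do: every generator of the filter lies in the ball.\<close>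
  obtain f0 where f0: "f0 \<in> carrier (spc P (Suc k))" using carrier_nonempty[OF step(2)] by blast
  have bounded: "\<forall>\<^sub>F x in F. x \<in> carrier (spc P k) \<and> nrm (spc P k) x \<le> ?R"
    using ev[OF f0, of 1] by (rule eventually_mono) (auto simp: N_def)
  have cl: "\<forall>\<^sub>F x in F. canon P k x \<in> carrier (spc P (Suc (Suc k)))"
    using bounded by (rule eventually_mono) (simp add: canon step)
  have "((\<lambda>x. pair P (Suc k) (canon P k x) f) \<longlongrightarrow> pair P (Suc k) z f) F"
    if f: "f \<in> carrier (spc P (Suc k))" for f
  proof (rule tendstoI)
    fix e :: real assume "0 < e"
    from ev[OF f this]
    show "\<forall>\<^sub>F x in F. dist (pair P (Suc k) (canon P k x) f) (pair P (Suc k) z f) < e"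
      by (rule eventually_mono) (use f in \<open>auto simp: N_def dist_norm pair_canon step\<close>)
  qed
  then have "limitin (weak_star_top P (Suc k)) (canon P k) z F"
    using z cl by (simp add: limitin_weak_star_top step)
  then show thesis using that[of F] \<open>F \<noteq> bot\<close> bounded by (auto simp: bounded_net_to_def)
qed

lemma bounded_net_tendsto:
  assumes F: "bounded_net_to P k F z" and \<phi>: "bounded_linear_map (spc P k) scalars \<phi>"
  shows "(\<phi> \<longlongrightarrow> bidual_eval P k z \<phi>) F"
proof -
  have "((\<lambda>x. pair P (Suc k) (canon P k x) (functional P k \<phi>)) \<longlongrightarrow> bidual_eval P k z \<phi>) F"
    using F functional(1)[OF step(1) \<phi>]
    by (simp add: bounded_net_to_def limitin_weak_star_top step bidual_eval_def)
  moreover have "\<forall>\<^sub>F x in F. pair P (Suc k) (canon P k x) (functional P k \<phi>) = \<phi> x"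
  proof -
    have "\<forall>\<^sub>F x in F. x \<in> carrier (spc P k)"
      using F by (auto simp: bounded_net_to_def elim: eventually_mono)
    then show ?thesis
      by (rule eventually_mono) (simp add: pair_canon functional step \<phi>)
  qed
  ultimately show ?thesis by (simp add: tendsto_cong)
qed

end

lemma bounded_net_to_carrier:
  "bounded_net_to P k F z \<Longrightarrow> \<forall>\<^sub>F x in F. x \<in> carrier (spc P k)"
  by (auto simp: bounded_net_to_def elim: eventually_mono)


section \<open>Extending bounded bilinear maps to the biduals\<close>

text \<open>The triple adjoint of \<open>h\<close>, that is, \<open>lim\<^sub>x lim\<^sub>y h x y\<close> with \<open>x\<close> tending to \<open>x''\<close> and \<open>y\<close> to \<open>y''\<close>.\<close>

definition arens_ext ::
  "('k, 'u) tower \<Rightarrow> ('k, 'v) tower \<Rightarrow> ('k, 'w) tower \<Rightarrow> nat \<Rightarrow>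
   ('u \<Rightarrow> 'v \<Rightarrow> 'w) \<Rightarrow> 'u \<Rightarrow> 'v \<Rightarrow> 'w" where
  "arens_ext P Q R k h x'' y'' = functional R (Suc k)
     (\<lambda>z'. bidual_eval P k x'' (\<lambda>x. bidual_eval Q k y'' (\<lambda>y. pair R k z' (h x y))))"

lemma arens_eq_arens_ext: "arens P k m = arens_ext P P P k m"
  by (simp add: fun_eq_iff arens_def arens_ext_def ar_2_def ar_1_def bidual_eval_def)

context
  fixes P :: "('k::real_normed_field, 'u::ab_group_add) tower"
    and Q :: "('k, 'v::ab_group_add) tower" and R :: "('k, 'w::ab_group_add) tower"
    and k :: nat and h :: "'u \<Rightarrow> 'v \<Rightarrow> 'w"
  assumes P: "dual_step P k" "dual_step P (Suc k)"
    and Q: "dual_step Q k" "dual_step Q (Suc k)"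
    and R: "dual_step R k" "dual_step R (Suc k)"
    and h: "bounded_bilinear_map (spc P k) (spc Q k) (spc R k) h"
begin

lemma bounded_bilinear_pair_map:
  "z' \<in> carrier (spc R (Suc k)) \<Longrightarrow>
    bounded_bilinear_map (spc P k) (spc Q k) scalars (\<lambda>x y. pair R k z' (h x y))"
  by (rule bounded_bilinear_map_postcompose[OF h bounded_pair[OF R(1)] dual_step_normed(1)[OF R(1)]])

lemma bounded_linear_inner_eval:
  "z' \<in> carrier (spc R (Suc k)) \<Longrightarrow> y'' \<in> carrier (spc Q (Suc (Suc k))) \<Longrightarrow>
    bounded_linear_map (spc P k) scalars (\<lambda>x. bidual_eval Q k y'' (\<lambda>y. pair R k z' (h x y)))"
  by (rule bounded_linear_bidual_eval[OF Q dual_step_normed(1)[OF P(1)] bounded_bilinear_pair_map])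

lemma
  shows bounded_bilinear_arens_ext:
    "bounded_bilinear_map (spc P (Suc (Suc k))) (spc Q (Suc (Suc k))) (spc R (Suc (Suc k)))
      (arens_ext P Q R k h)"
    and bounded_linear_iterated_eval:
    "\<And>x'' y''. x'' \<in> carrier (spc P (Suc (Suc k))) \<Longrightarrow> y'' \<in> carrier (spc Q (Suc (Suc k))) \<Longrightarrow>
      bounded_linear_map (spc R (Suc k)) scalars
        (\<lambda>z'. bidual_eval P k x'' (\<lambda>x. bidual_eval Q k y'' (\<lambda>y. pair R k z' (h x y))))"
proof -
  let ?t = "\<lambda>x'' y'' z'. bidual_eval P k x'' (\<lambda>x. bidual_eval Q k y'' (\<lambda>y. pair R k z' (h x y)))"
  let ?P = "spc P (Suc (Suc k))" and ?Q = "spc Q (Suc (Suc k))" and ?R = "spc R (Suc k)"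
  note nP = dual_step_normed[OF P(1)] dual_step_normed(2)[OF P(2)]
  note nQ = dual_step_normed[OF Q(1)] dual_step_normed(2)[OF Q(2)]
  note nR = dual_step_normed[OF R(1)]
  note sec = bounded_bilinear_map_section[OF bounded_bilinear_pair_map]
  obtain K where K: "0 \<le> K" "\<And>x y. x \<in> carrier (spc P k) \<Longrightarrow> y \<in> carrier (spc Q k) \<Longrightarrow>
      nrm (spc R k) (h x y) \<le> K * nrm (spc P k) x * nrm (spc Q k) y"
    by (rule bounded_bilinear_map_bound[OF h]) blast
  have t1: "linear_map ?Q scalars (\<lambda>y''. ?t x'' y'' z')"
    if x'': "x'' \<in> carrier ?P" and z': "z' \<in> carrier ?R" for x'' z'
    using bounded_linear_bidual_eval[OF P nQ(3) bounded_bilinear_map_flip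
        [OF bounded_bilinear_bidual_eval[OF Q nP(1) bounded_bilinear_pair_map[OF z']]] x'']
    by (simp add: bounded_linear_map_def)
  have t2: "linear_map ?P scalars (\<lambda>x''. ?t x'' y'' z')"
    if y'': "y'' \<in> carrier ?Q" and z': "z' \<in> carrier ?R" for y'' z'
    using bidual_eval_add_left[OF P] bidual_eval_scale_left[OF P] bounded_linear_inner_eval[OF z' y'']
    by (simp add: linear_map_def)
  have t3: "linear_map ?R scalars (?t x'' y'')"
    if x'': "x'' \<in> carrier ?P" and y'': "y'' \<in> carrier ?Q" for x'' y''
    unfolding linear_map_def
  proof (intro conjI ballI allI)
    fix z w assume z: "z \<in> carrier ?R" and w: "w \<in> carrier ?R"
    have "?t x'' y'' (z + w) = bidual_eval P k x'' (\<lambda>x.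
        bidual_eval Q k y'' (\<lambda>y. pair R k z (h x y) + pair R k w (h x y)))"
      by (intro bidual_eval_cong) (simp add: pair_bilinear R z w bounded_bilinear_mapD(1)[OF h])
    also have "\<dots> = bidual_eval P k x'' (\<lambda>x.
        bidual_eval Q k y'' (\<lambda>y. pair R k z (h x y)) + bidual_eval Q k y'' (\<lambda>y. pair R k w (h x y)))"
      by (intro bidual_eval_cong bidual_eval_add[OF Q y''] sec z w)
    also have "\<dots> = ?t x'' y'' z + ?t x'' y'' w"
      by (intro bidual_eval_add[OF P x''] bounded_linear_inner_eval z w y'')
    finally show "?t x'' y'' (z + w) = ?t x'' y'' z + ?t x'' y'' w" .
  next
    fix c z assume z: "z \<in> carrier ?R"
    have "?t x'' y'' (scl ?R c z) = bidual_eval P k x'' (\<lambda>x.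
        bidual_eval Q k y'' (\<lambda>y. c * pair R k z (h x y)))"
      by (intro bidual_eval_cong) (simp add: pair_bilinear R z bounded_bilinear_mapD(1)[OF h])
    also have "\<dots> = bidual_eval P k x'' (\<lambda>x. c * bidual_eval Q k y'' (\<lambda>y. pair R k z (h x y)))"
      by (intro bidual_eval_cong bidual_eval_scale[OF Q y''] sec z)
    also have "\<dots> = c * ?t x'' y'' z"
      by (intro bidual_eval_scale[OF P x''] bounded_linear_inner_eval z y'')
    finally show "?t x'' y'' (scl ?R c z) = scl scalars c (?t x'' y'' z)" by simp
  qed simp
  have bound: "norm (?t x'' y'' z') \<le> K * nrm ?P x'' * nrm ?Q y'' * nrm ?R z'"
    if x'': "x'' \<in> carrier ?P" and y'': "y'' \<in> carrier ?Q" and z': "z' \<in> carrier ?R" for x'' y'' z'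
  proof -
    note nz = normed_space_nrm(1)[OF nR(2) z'] and ny = normed_space_nrm(1)[OF nQ(3) y'']
    have 1: "norm (pair R k z' (h x y)) \<le> (nrm ?R z' * (K * nrm (spc P k) x)) * nrm (spc Q k) y"
      if "x \<in> carrier (spc P k)" "y \<in> carrier (spc Q k)" for x y
      using norm_pair_le[OF R(1) z' bounded_bilinear_mapD(1)[OF h that]]
        mult_left_mono[OF K(2)[OF that] nz] by (simp add: mult.assoc)
    have 2: "norm (bidual_eval Q k y'' (\<lambda>y. pair R k z' (h x y)))
        \<le> nrm ?Q y'' * (nrm ?R z' * (K * nrm (spc P k) x))" if x: "x \<in> carrier (spc P k)" for x
      by (rule norm_bidual_eval_le[OF Q y'' sec[OF z' x]])
        (use 1 x nz K(1) normed_space_nrm(1)[OF nP(1) x] in auto)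
    have "norm (?t x'' y'' z') \<le> nrm ?P x'' * (nrm ?Q y'' * nrm ?R z' * K)"
      by (rule norm_bidual_eval_le[OF P x'' bounded_linear_inner_eval[OF z' y'']])
        (use 2 nz ny K(1) in \<open>auto simp: mult_ac\<close>)
    then show ?thesis by (simp add: mult_ac)
  qed
  note main = bounded_bilinear_functional[OF R(2) nP(3) nQ(3) t1 t2 t3 K(1) bound]
  show "bounded_bilinear_map ?P ?Q (spc R (Suc (Suc k))) (arens_ext P Q R k h)"
    unfolding arens_ext_def[abs_def] by (rule main(1))
  show "\<And>x'' y''. x'' \<in> carrier ?P \<Longrightarrow> y'' \<in> carrier ?Q \<Longrightarrow> bounded_linear_map ?R scalars (?t x'' y'')"
    by (rule main(2))
qed

lemma arens_ext_closed:
  "x'' \<in> carrier (spc P (Suc (Suc k))) \<Longrightarrow> y'' \<in> carrier (spc Q (Suc (Suc k))) \<Longrightarrow>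
    arens_ext P Q R k h x'' y'' \<in> carrier (spc R (Suc (Suc k)))"
  by (rule bounded_bilinear_mapD(1)[OF bounded_bilinear_arens_ext])

lemma pair_arens_ext:
  "x'' \<in> carrier (spc P (Suc (Suc k))) \<Longrightarrow> y'' \<in> carrier (spc Q (Suc (Suc k))) \<Longrightarrow>
    z' \<in> carrier (spc R (Suc k)) \<Longrightarrow>
    pair R (Suc k) (arens_ext P Q R k h x'' y'') z' =
      bidual_eval P k x'' (\<lambda>x. bidual_eval Q k y'' (\<lambda>y. pair R k z' (h x y)))"
  unfolding arens_ext_def by (rule pair_functional[OF R(2) bounded_linear_iterated_eval])

lemma bidual_eval_arens_ext:
  assumes x'': "x'' \<in> carrier (spc P (Suc (Suc k)))" and y'': "y'' \<in> carrier (spc Q (Suc (Suc k)))"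
    and \<psi>: "bounded_linear_map (spc R k) scalars \<psi>"
  shows "bidual_eval R k (arens_ext P Q R k h x'' y'') \<psi> =
      bidual_eval P k x'' (\<lambda>x. bidual_eval Q k y'' (\<lambda>y. \<psi> (h x y)))"
proof -
  have "bidual_eval R k (arens_ext P Q R k h x'' y'') \<psi> = bidual_eval P k x''
      (\<lambda>x. bidual_eval Q k y'' (\<lambda>y. pair R k (functional R k \<psi>) (h x y)))"
    unfolding bidual_eval_def[of R]
    by (rule pair_arens_ext[OF x'' y'' functional_closed[OF R(1) \<psi>]])
  also have "\<dots> = bidual_eval P k x'' (\<lambda>x. bidual_eval Q k y'' (\<lambda>y. \<psi> (h x y)))"
    by (intro bidual_eval_cong) (simp add: pair_functional R \<psi> bounded_bilinear_mapD(1)[OF h])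
  finally show ?thesis .
qed

end

context
  fixes P :: "('k::{real_normed_field, euclidean_space}, 'u::ab_group_add) tower"
    and Q :: "('k, 'v::ab_group_add) tower" and R :: "('k, 'w::ab_group_add) tower"
    and k :: nat and h :: "'u \<Rightarrow> 'v \<Rightarrow> 'w"
  assumes P: "dual_step P k" "dual_step P (Suc k)"
    and Q: "dual_step Q k" "dual_step Q (Suc k)"
    and R: "dual_step R k" "dual_step R (Suc k)"
    and h: "bounded_bilinear_map (spc P k) (spc Q k) (spc R k) h"
begin

lemma iterated_limit_arens_ext:
  assumes x'': "x'' \<in> carrier (spc P (Suc (Suc k)))" and y'': "y'' \<in> carrier (spc Q (Suc (Suc k)))"
    and F: "bounded_net_to P k F x''" and G: "bounded_net_to Q k G y''"
  shows "iterated_limit (weak_star_top R (Suc k)) (\<lambda>x y. canon R k (h x y)) F G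
    (arens_ext P Q R k h x'' y'')"
proof -
  note form = bounded_bilinear_pair_map[OF P Q R h] and inner = bounded_linear_inner_eval[OF P Q R h]
  \<comment> \<open>The inner limit is the iterated one at a canonical image, which gives its boundedness.\<close>
  have section_bound: "bounded_linear_map (spc R (Suc k)) scalars
      (\<lambda>z'. bidual_eval Q k y'' (\<lambda>y. pair R k z' (h x y)))" if x: "x \<in> carrier (spc P k)" for x
  proof -
    have "bounded_linear_map (spc R (Suc k)) scalars (\<lambda>z'. bidual_eval P k (canon P k x)
        (\<lambda>x. bidual_eval Q k y'' (\<lambda>y. pair R k z' (h x y))))"
      by (rule bounded_linear_iterated_eval[OF P Q R h canon_closed[OF P x] y''])
    moreover have "bidual_eval P k (canon P k x) (\<lambda>x. bidual_eval Q k y'' (\<lambda>y. pair R k z' (h x y)))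
        = bidual_eval Q k y'' (\<lambda>y. pair R k z' (h x y))" if "z' \<in> carrier (spc R (Suc k))" for z'
      by (rule bidual_eval_canon[OF P x inner[OF that y'']])
    ultimately show ?thesis
      using normed_space_closed[OF dual_step_normed(2)[OF R(1)]]
      by (simp add: bounded_linear_map_def linear_map_def)
  qed
  define g where "g x = functional R (Suc k) (\<lambda>z'. bidual_eval Q k y'' (\<lambda>y. pair R k z' (h x y)))" for x
  have g: "g x \<in> carrier (spc R (Suc (Suc k)))"
    "\<And>z'. z' \<in> carrier (spc R (Suc k)) \<Longrightarrow>
      pair R (Suc k) (g x) z' = bidual_eval Q k y'' (\<lambda>y. pair R k z' (h x y))"
    if "x \<in> carrier (spc P k)" for x
    unfolding g_def using functional[OF R(2) section_bound[OF that]] by auto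
  note evF = bounded_net_to_carrier[OF F] and evG = bounded_net_to_carrier[OF G]
  have "limitin (weak_star_top R (Suc k)) (\<lambda>y. canon R k (h x y)) (g x) G"
    if x: "x \<in> carrier (spc P k)" for x
    unfolding limitin_weak_star_top[OF R(2)]
  proof (intro conjI ballI)
    note hD = bounded_bilinear_mapD(1)[OF h x]
    show "\<forall>\<^sub>F y in G. canon R k (h x y) \<in> carrier (spc R (Suc (Suc k)))"
      using evG by (rule eventually_mono) (simp add: canon_closed R hD)
    fix z' assume z': "z' \<in> carrier (spc R (Suc k))"
    have "((\<lambda>y. pair R k z' (h x y)) \<longlongrightarrow> pair R (Suc k) (g x) z') G"
      using bounded_net_tendsto[OF Q G bounded_bilinear_map_section[OF form[OF z'] x]]
      by (simp add: g x z')
    moreover have "\<forall>\<^sub>F y in G. pair R (Suc k) (canon R k (h x y)) z' = pair R k z' (h x y)"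
      using evG by (rule eventually_mono) (simp add: pair_canon R hD z')
    ultimately show "((\<lambda>y. pair R (Suc k) (canon R k (h x y)) z') \<longlongrightarrow> pair R (Suc k) (g x) z') G"
      by (simp add: tendsto_cong)
  qed (simp add: g x)
  then have 1: "\<forall>\<^sub>F x in F. limitin (weak_star_top R (Suc k)) (\<lambda>y. canon R k (h x y)) (g x) G"
    using evF by (auto elim: eventually_mono)
  have "limitin (weak_star_top R (Suc k)) g (arens_ext P Q R k h x'' y'') F"
    unfolding limitin_weak_star_top[OF R(2)]
  proof (intro conjI ballI)
    show "\<forall>\<^sub>F x in F. g x \<in> carrier (spc R (Suc (Suc k)))"
      using evF by (rule eventually_mono) (rule g)
    show "arens_ext P Q R k h x'' y'' \<in> carrier (spc R (Suc (Suc k)))"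
      by (rule arens_ext_closed[OF P Q R h x'' y''])
    fix z' assume z': "z' \<in> carrier (spc R (Suc k))"
    have "((\<lambda>x. bidual_eval Q k y'' (\<lambda>y. pair R k z' (h x y))) \<longlongrightarrow>
        pair R (Suc k) (arens_ext P Q R k h x'' y'') z') F"
      using bounded_net_tendsto[OF P F inner[OF z' y'']]
      by (simp add: pair_arens_ext[OF P Q R h x'' y'' z'])
    moreover have "\<forall>\<^sub>F x in F. pair R (Suc k) (g x) z' = bidual_eval Q k y'' (\<lambda>y. pair R k z' (h x y))"
      using evF by (rule eventually_mono) (simp add: g z')
    ultimately show "((\<lambda>x. pair R (Suc k) (g x) z') \<longlongrightarrow>
        pair R (Suc k) (arens_ext P Q R k h x'' y'') z') F"
      by (simp add: tendsto_cong)
  qed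
  with 1 show ?thesis by (auto simp: iterated_limit_def)
qed

end

lemma iterated_limit_weak_star_unique:
  fixes R :: "('k::{real_normed_field, euclidean_space}, 'w::ab_group_add) tower"
  assumes R: "dual_step R k" and F: "F \<noteq> bot" and G: "G \<noteq> bot"
    and z1: "iterated_limit (weak_star_top R k) f F G z1"
    and z2: "iterated_limit (weak_star_top R k) f F G z2"
  shows "z1 = z2"
proof -
  obtain g1 where g1: "\<forall>\<^sub>F x in F. limitin (weak_star_top R k) (f x) (g1 x) G"
    "limitin (weak_star_top R k) g1 z1 F"
    using z1 by (auto simp: iterated_limit_def)
  obtain g2 where g2: "\<forall>\<^sub>F x in F. limitin (weak_star_top R k) (f x) (g2 x) G"
    "limitin (weak_star_top R k) g2 z2 F"
    using z2 by (auto simp: iterated_limit_def)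
  show ?thesis
  proof (rule dual_eqI[OF R])
    fix w assume w: "w \<in> carrier (spc R k)"
    have eq: "\<forall>\<^sub>F x in F. pair R k (g1 x) w = pair R k (g2 x) w"
      using g1(1) g2(1)
    proof (rule eventually_elim2)
      fix x assume "limitin (weak_star_top R k) (f x) (g1 x) G"
        and "limitin (weak_star_top R k) (f x) (g2 x) G"
      then show "pair R k (g1 x) w = pair R k (g2 x) w"
        using w by (intro tendsto_unique[OF G, where f = "\<lambda>y. pair R k (f x y) w"])
          (auto simp: limitin_weak_star_top[OF R])
    qed
    have lim: "((\<lambda>x. pair R k (g1 x) w) \<longlongrightarrow> pair R k z1 w) F"
      "((\<lambda>x. pair R k (g2 x) w) \<longlongrightarrow> pair R k z2 w) F"
      using g1 g2 w by (auto simp: limitin_weak_star_top[OF R])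
    show "pair R k z1 w = pair R k z2 w"
      by (rule tendsto_unique[OF F tendsto_cong[OF eq, THEN iffD1, OF lim(1)] lim(2)])
  qed (use g1 g2 in \<open>auto simp: limitin_weak_star_top[OF R]\<close>)
qed

context
  fixes P :: "('k::{real_normed_field, euclidean_space}, 'u::ab_group_add) tower"
    and Q :: "('k, 'v::ab_group_add) tower" and k :: nat
  assumes P: "dual_step P k" "dual_step P (Suc k)"
    and Q: "dual_step Q k" "dual_step Q (Suc k)"
begin

text \<open>Uniqueness of the limit needs one pair of nets, hence Goldstine's theorem; existence is needed
  for all of them.\<close>

lemma bidual_left_eq_arens_ext:
  assumes l: "bounded_bilinear_map (spc P k) (spc Q k) (spc Q k) l"
    and b: "b \<in> carrier (spc P (Suc (Suc k)))" and y: "y \<in> carrier (spc Q (Suc (Suc k)))"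
  shows "bidual_left P Q k l b y = arens_ext P Q Q k l b y"
proof -
  obtain F where F: "bounded_net_to P k F b" by (rule bounded_net_exists[OF P b])
  obtain G where G: "bounded_net_to Q k G y" by (rule bounded_net_exists[OF Q y])
  have ne: "F \<noteq> bot" "G \<noteq> bot" using F G by (auto simp: bounded_net_to_def)
  note lim = iterated_limit_arens_ext[OF P Q Q l b y]
  show ?thesis
    unfolding bidual_left_def
    by (rule the_equality)
      (use arens_ext_closed[OF P Q Q l b y] lim
        iterated_limit_weak_star_unique[OF Q(2) ne _ lim[OF F G]] F G in auto)
qed

lemma bidual_right_eq_arens_ext:
  assumes r: "bounded_bilinear_map (spc Q k) (spc P k) (spc Q k) r"
    and b: "b \<in> carrier (spc P (Suc (Suc k)))" and y: "y \<in> carrier (spc Q (Suc (Suc k)))"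
  shows "bidual_right P Q k r y b = arens_ext Q P Q k r y b"
proof -
  obtain F where F: "bounded_net_to P k F b" by (rule bounded_net_exists[OF P b])
  obtain G where G: "bounded_net_to Q k G y" by (rule bounded_net_exists[OF Q y])
  have ne: "G \<noteq> bot" "F \<noteq> bot" using F G by (auto simp: bounded_net_to_def)
  note lim = iterated_limit_arens_ext[OF Q P Q r y b]
  show ?thesis
    unfolding bidual_right_def
    by (rule the_equality)
      (use arens_ext_closed[OF Q P Q r y b] lim
        iterated_limit_weak_star_unique[OF Q(2) ne _ lim[OF G F]] F G in auto)
qed

end


section \<open>Second adjoints and dual actions\<close>

lemma bounded_linear_functional:
  assumes R: "dual_step R j" and E: "normed_space E"
    and t: "bounded_bilinear_map E (spc R j) scalars t"
  shows "bounded_linear_map E (spc R (Suc j)) (\<lambda>x. functional R j (t x))"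
proof -
  obtain K where K: "0 \<le> K"
    "\<And>x z. x \<in> carrier E \<Longrightarrow> z \<in> carrier (spc R j) \<Longrightarrow> norm (t x z) \<le> K * nrm E x * nrm (spc R j) z"
    using bounded_bilinear_map_bound[OF t] by auto
  note tD = bounded_bilinear_mapD[OF t]
  note f = functional[OF R bounded_bilinear_map_section[OF t]]
  note cl = normed_space_closed[OF dual_step_normed(2)[OF R]] and clE = normed_space_closed[OF E]
  show ?thesis
  proof (rule bounded_linear_mapI[where C = K])
    fix x assume x: "x \<in> carrier E"
    show "nrm (spc R (Suc j)) (functional R j (t x)) \<le> K * nrm E x"
    proof (rule dual_nrm_le[OF R f(1)[OF x]])
      fix z assume z: "z \<in> carrier (spc R j)" "nrm (spc R j) z \<le> 1"
      have "norm (t x z) \<le> K * nrm E x * nrm (spc R j) z" using K x z by blast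
      also have "\<dots> \<le> K * nrm E x * 1"
        using K x z normed_space_nrm(1)[OF E x] by (intro mult_left_mono) auto
      finally show "norm (pair R j (functional R j (t x)) z) \<le> K * nrm E x"
        using f x z by simp
    qed
  next
    fix x y assume "x \<in> carrier E" "y \<in> carrier E"
    then show "functional R j (t (x + y)) = functional R j (t x) + functional R j (t y)"
      by (intro dual_eqI[OF R]) (use f cl clE tD pair_bilinear[OF R] in auto)
  next
    fix c x assume "x \<in> carrier E"
    then show "functional R j (t (scl E c x)) = scl (spc R (Suc j)) c (functional R j (t x))"
      by (intro dual_eqI[OF R]) (use f cl clE tD pair_bilinear[OF R] in auto)
  qed (rule f)
qed

context
  fixes P :: "('k::real_normed_field, 'u::ab_group_add) tower"
    and Q :: "('k, 'v::ab_group_add) tower" and j k :: nat and T :: "'u \<Rightarrow> 'v"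
  assumes P: "dual_step P j" "dual_step P (Suc j)"
    and Q: "dual_step Q k" "dual_step Q (Suc k)"
    and T: "bounded_linear_map (spc P j) (spc Q k) T"
begin

lemma second_adj_eq:
  "second_adj P j Q k T x'' =
    functional Q (Suc k) (\<lambda>g. bidual_eval P j x'' (\<lambda>x. pair Q k g (T x)))"
  by (simp add: second_adj_def adj_def bidual_eval_def)

lemma bounded_bilinear_second_adj_form:
  "bounded_bilinear_map (spc P (Suc (Suc j))) (spc Q (Suc k)) scalars
    (\<lambda>x'' g. bidual_eval P j x'' (\<lambda>x. pair Q k g (T x)))"
proof -
  have id: "bounded_linear_map (spc Q (Suc k)) (spc Q (Suc k)) (\<lambda>g. g)"
    by (rule bounded_linear_mapI[where C = 1]) auto
  note n = dual_step_normed[OF Q(1)] dual_step_normed(1)[OF P(1)]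
  have "bounded_bilinear_map (spc Q (Suc k)) (spc P j) scalars (\<lambda>g x. pair Q k g (T x))"
    by (rule bounded_bilinear_map_compose[OF bounded_bilinear_pair[OF Q(1)] id T n(2,3,2,1)])
  from bounded_bilinear_map_flip[OF bounded_bilinear_bidual_eval[OF P n(2) this]]
  show ?thesis .
qed

lemma bounded_linear_second_adj:
  "bounded_linear_map (spc P (Suc (Suc j))) (spc Q (Suc (Suc k))) (second_adj P j Q k T)"
  unfolding second_adj_eq[abs_def]
  by (rule bounded_linear_functional
      [OF Q(2) dual_step_normed(2)[OF P(2)] bounded_bilinear_second_adj_form])

lemma pair_second_adj:
  "x'' \<in> carrier (spc P (Suc (Suc j))) \<Longrightarrow> g \<in> carrier (spc Q (Suc k)) \<Longrightarrow>
    pair Q (Suc k) (second_adj P j Q k T x'') g = bidual_eval P j x'' (\<lambda>x. pair Q k g (T x))"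
  unfolding second_adj_eq
  by (rule pair_functional[OF Q(2) bounded_bilinear_map_section[OF bounded_bilinear_second_adj_form]])

lemma bidual_eval_second_adj:
  assumes "x'' \<in> carrier (spc P (Suc (Suc j)))" and \<psi>: "bounded_linear_map (spc Q k) scalars \<psi>"
  shows "bidual_eval Q k (second_adj P j Q k T x'') \<psi> = bidual_eval P j x'' (\<lambda>x. \<psi> (T x))"
proof -
  have "bidual_eval Q k (second_adj P j Q k T x'') \<psi> =
      bidual_eval P j x'' (\<lambda>x. pair Q k (functional Q k \<psi>) (T x))"
    unfolding bidual_eval_def[of Q]
    by (rule pair_second_adj[OF assms(1) functional_closed[OF Q(1) \<psi>]])
  also have "\<dots> = bidual_eval P j x'' (\<lambda>x. \<psi> (T x))"
    by (intro bidual_eval_cong) (simp add: pair_functional Q \<psi> bounded_linear_mapD(1)[OF T])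
  finally show ?thesis .
qed

lemma second_adj_canon:
  assumes x: "x \<in> carrier (spc P j)"
  shows "second_adj P j Q k T (canon P j x) = canon Q k (T x)"
proof (rule dual_eqI[OF Q(2)])
  note Tx = bounded_linear_mapD(1)[OF T x]
  show "second_adj P j Q k T (canon P j x) \<in> carrier (spc Q (Suc (Suc k)))"
    by (rule bounded_linear_mapD(1)[OF bounded_linear_second_adj canon_closed[OF P x]])
  show "canon Q k (T x) \<in> carrier (spc Q (Suc (Suc k)))"
    by (rule canon_closed[OF Q Tx])
  fix g assume g: "g \<in> carrier (spc Q (Suc k))"
  have "bounded_linear_map (spc P j) scalars (\<lambda>x. pair Q k g (T x))"
    by (rule bounded_linear_map_compose[OF T bounded_pair[OF Q(1) g]])
      (rule dual_step_normed(1)[OF P(1)] dual_step_normed(1)[OF Q(1)])+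
  then show "pair Q (Suc k) (second_adj P j Q k T (canon P j x)) g = pair Q (Suc k) (canon Q k (T x)) g"
    by (simp add: pair_second_adj canon_closed P x g bidual_eval_canon pair_canon Q Tx)
qed

end

context
  fixes Q :: "('k::real_normed_field, 'v::ab_group_add) tower" and k :: nat
    and B :: "('k, 'u::ab_group_add) nspace"
  assumes Q: "dual_step Q k" and B: "normed_space B"
begin

lemma
  assumes r: "bounded_bilinear_map (spc Q k) B (spc Q k) r"
  shows bounded_bilinear_dual_left:
      "bounded_bilinear_map B (spc Q (Suc k)) (spc Q (Suc k)) (dual_left Q k r)"
    and pair_dual_left: "\<And>b y' y. b \<in> carrier B \<Longrightarrow> y' \<in> carrier (spc Q (Suc k)) \<Longrightarrow>
      y \<in> carrier (spc Q k) \<Longrightarrow> pair Q k (dual_left Q k r b y') y = pair Q k y' (r y b)"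
proof -
  note nQ = dual_step_normed[OF Q]
  note rD = bounded_bilinear_mapD[OF r]
  obtain K where K: "0 \<le> K" "\<And>y b. y \<in> carrier (spc Q k) \<Longrightarrow> b \<in> carrier B \<Longrightarrow>
      nrm (spc Q k) (r y b) \<le> K * nrm (spc Q k) y * nrm B b"
    by (rule bounded_bilinear_map_bound[OF r]) blast
  have bound: "norm (pair Q k y' (r y b)) \<le> K * nrm B b * nrm (spc Q (Suc k)) y' * nrm (spc Q k) y"
    if "b \<in> carrier B" "y' \<in> carrier (spc Q (Suc k))" "y \<in> carrier (spc Q k)" for b y' y
    using norm_pair_le[OF Q that(2) rD(1)[OF that(3,1)]]
      mult_left_mono[OF K(2)[OF that(3,1)] normed_space_nrm(1)[OF nQ(2) that(2)]]
    by (simp add: mult_ac)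
  note main = bounded_bilinear_functional[OF Q B nQ(2), where t = "\<lambda>b y' y. pair Q k y' (r y b)",
      OF _ _ _ K(1) bound]
  have *: "bounded_bilinear_map B (spc Q (Suc k)) (spc Q (Suc k))
        (\<lambda>b y'. functional Q k (\<lambda>y. pair Q k y' (r y b)))"
    "\<And>b y'. b \<in> carrier B \<Longrightarrow> y' \<in> carrier (spc Q (Suc k)) \<Longrightarrow>
        bounded_linear_map (spc Q k) scalars (\<lambda>y. pair Q k y' (r y b))"
    by (rule main; simp add: linear_map_def rD pair_bilinear Q)+
  show "bounded_bilinear_map B (spc Q (Suc k)) (spc Q (Suc k)) (dual_left Q k r)"
    using *(1) by (simp add: dual_left_def[abs_def])
  show "\<And>b y' y. b \<in> carrier B \<Longrightarrow> y' \<in> carrier (spc Q (Suc k)) \<Longrightarrow>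
      y \<in> carrier (spc Q k) \<Longrightarrow> pair Q k (dual_left Q k r b y') y = pair Q k y' (r y b)"
    by (simp add: dual_left_def functional Q *(2))
qed

lemma
  assumes l: "bounded_bilinear_map B (spc Q k) (spc Q k) l"
  shows bounded_bilinear_dual_right:
      "bounded_bilinear_map (spc Q (Suc k)) B (spc Q (Suc k)) (dual_right Q k l)"
    and pair_dual_right: "\<And>b y' y. b \<in> carrier B \<Longrightarrow> y' \<in> carrier (spc Q (Suc k)) \<Longrightarrow>
      y \<in> carrier (spc Q k) \<Longrightarrow> pair Q k (dual_right Q k l y' b) y = pair Q k y' (l b y)"
proof -
  note r = bounded_bilinear_map_flip[OF l]
  have eq: "dual_right Q k l = (\<lambda>y' b. dual_left Q k (\<lambda>y b. l b y) b y')"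
    by (simp add: fun_eq_iff dual_left_def dual_right_def)
  show "bounded_bilinear_map (spc Q (Suc k)) B (spc Q (Suc k)) (dual_right Q k l)"
    unfolding eq by (rule bounded_bilinear_map_flip[OF bounded_bilinear_dual_left[OF r]])
  show "\<And>b y' y. b \<in> carrier B \<Longrightarrow> y' \<in> carrier (spc Q (Suc k)) \<Longrightarrow>
      y \<in> carrier (spc Q k) \<Longrightarrow> pair Q k (dual_right Q k l y' b) y = pair Q k y' (l b y)"
    unfolding eq by (rule pair_dual_left[OF r])
qed

end


section \<open>The derivation identity on the bidual\<close>

text \<open>A weak* continuous function on the bidual is determined by its values on the image of the space.
  Here the values there are those of a bounded functional \<open>\<phi>\<close>, so the function is evaluation at \<open>\<phi>\<close>.\<close>

lemma continuous_eval_canon: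
  fixes P :: "('k::{real_normed_field, euclidean_space}, 'u::ab_group_add) tower"
    and Q :: "('k, 'v::ab_group_add) tower"
  assumes P: "dual_step P k" "dual_step P (Suc k)" and Q: "dual_step Q j"
    and f: "continuous_map (weak_star_top P (Suc k)) (weak_top Q j) f"
    and g: "g \<in> carrier (spc Q (Suc j))"
    and z: "z \<in> carrier (spc P (Suc (Suc k)))"
    and \<phi>: "bounded_linear_map (spc P k) scalars \<phi>"
      "\<And>x. x \<in> carrier (spc P k) \<Longrightarrow> pair Q j g (f (canon P k x)) = \<phi> x"
  shows "pair Q j g (f z) = bidual_eval P k z \<phi>"
proof -
  obtain F where F: "bounded_net_to P k F z" by (rule bounded_net_exists[OF P z])
  then have ne: "F \<noteq> bot" and lim: "limitin (weak_star_top P (Suc k)) (canon P k) z F"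
    by (auto simp: bounded_net_to_def)
  have "((\<lambda>x. pair Q j g (f (canon P k x))) \<longlongrightarrow> pair Q j g (f z)) F"
    using continuous_map_limit[OF f lim] g by (auto simp: limitin_weak_top[OF Q])
  moreover have "\<forall>\<^sub>F x in F. pair Q j g (f (canon P k x)) = \<phi> x"
    using bounded_net_to_carrier[OF F] by (rule eventually_mono) (rule \<phi>(2))
  ultimately have "(\<phi> \<longlongrightarrow> pair Q j g (f z)) F" by (simp add: tendsto_cong)
  then show ?thesis using tendsto_unique[OF ne _ bounded_net_tendsto[OF P F \<phi>(1)]] by blast
qed

text \<open>With \<open>\<alpha>\<close> and \<open>\<beta>\<close> the two summands of \<open>\<langle>w, D(xy)\<rangle>\<close>, each of the three terms of the
  identity paired with \<open>w\<close> becomes an iterated evaluation of \<open>\<alpha>\<close> or \<open>\<beta>\<close>.  Only the one with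
  \<open>\<alpha>\<close> on the right-hand side uses continuity.\<close>

lemma ts_derivation_second_adj:
  fixes P :: "('k::{real_normed_field, euclidean_space}, 'u::ab_group_add) tower"
    and Q :: "('k, 'v::ab_group_add) tower"
  assumes P: "dual_step P k" "dual_step P (Suc k)"
    and Q: "dual_step Q k" "dual_step Q (Suc k)" "dual_step Q (Suc (Suc k))"
    and m: "bounded_bilinear_map (spc P k) (spc P k) (spc P k) m"
    and l: "bounded_bilinear_map (spc P k) (spc Q k) (spc Q k) l"
    and r: "bounded_bilinear_map (spc Q k) (spc P k) (spc Q k) r"
    and cont: "\<And>x. x \<in> carrier (spc Q (Suc (Suc k))) \<Longrightarrow>
      continuous_map (weak_star_top P (Suc k)) (weak_top Q (Suc (Suc k)))
        (\<lambda>a. arens_ext Q P Q k r x (second_adj P k P k T a))"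
    and der: "ts_derivation (spc P k) m (spc Q (Suc k)) (dual_left Q k r) (dual_right Q k l) T S D"
  shows "ts_derivation (spc P (Suc (Suc k))) (arens_ext P P P k m) (spc Q (Suc (Suc (Suc k))))
    (dual_left Q (Suc (Suc k)) (arens_ext Q P Q k r))
    (dual_right Q (Suc (Suc k)) (arens_ext P Q Q k l))
    (second_adj P k P k T) (second_adj P k P k S) (second_adj P k Q (Suc k) D)"
proof -
  let ?T = "second_adj P k P k T" and ?S = "second_adj P k P k S" and ?D = "second_adj P k Q (Suc k) D"
  let ?l = "arens_ext P Q Q k l" and ?r = "arens_ext Q P Q k r"
  note nP = dual_step_normed[OF P(1)] dual_step_normed(2)[OF P(2)]
  note nQ = dual_step_normed[OF Q(1)] dual_step_normed(2)[OF Q(2)]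
  note Q' = Q(2,3) and Q01 = Q(1,2)
  have T: "bounded_linear_map (spc P k) (spc P k) T" and S: "bounded_linear_map (spc P k) (spc P k) S"
    and D: "bounded_linear_map (spc P k) (spc Q (Suc k)) D"
    and prod: "\<And>a b. a \<in> carrier (spc P k) \<Longrightarrow> b \<in> carrier (spc P k) \<Longrightarrow>
      D (m a b) = dual_left Q k r (T a) (D b) + dual_right Q k l (D a) (S b)"
    using der by (auto simp: ts_derivation_def)
  note T2 = bounded_linear_second_adj[OF P P T] and S2 = bounded_linear_second_adj[OF P P S]
    and D2 = bounded_linear_second_adj[OF P Q' D]
  note left = bounded_bilinear_dual_left[OF Q(1) nP(1) r]
    and right = bounded_bilinear_dual_right[OF Q(1) nP(1) l]
  note r2 = bounded_bilinear_arens_ext[OF Q01 P Q01 r] and l2 = bounded_bilinear_arens_ext[OF P Q01 Q01 l]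
  note left2 = bounded_bilinear_dual_left[OF Q(3) nP(3) r2]
    and right2 = bounded_bilinear_dual_right[OF Q(3) nP(3) l2]
  have main: "?D (arens_ext P P P k m a b) =
      dual_left Q (Suc (Suc k)) ?r (?T a) (?D b) + dual_right Q (Suc (Suc k)) ?l (?D a) (?S b)"
    if a: "a \<in> carrier (spc P (Suc (Suc k)))" and b: "b \<in> carrier (spc P (Suc (Suc k)))" for a b
  proof (rule dual_eqI[OF Q(3)])
    note Ta = bounded_linear_mapD(1)[OF T2 a] and Sb = bounded_linear_mapD(1)[OF S2 b]
      and Da = bounded_linear_mapD(1)[OF D2 a] and Db = bounded_linear_mapD(1)[OF D2 b]
    note ab = arens_ext_closed[OF P P P m a b]
    note L = bounded_bilinear_mapD(1)[OF left2 Ta Db] and R = bounded_bilinear_mapD(1)[OF right2 Da Sb]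
    show "?D (arens_ext P P P k m a b) \<in> carrier (spc Q (Suc (Suc (Suc k))))"
      by (rule bounded_linear_mapD(1)[OF D2 ab])
    show "dual_left Q (Suc (Suc k)) ?r (?T a) (?D b) + dual_right Q (Suc (Suc k)) ?l (?D a) (?S b)
        \<in> carrier (spc Q (Suc (Suc (Suc k))))"
      by (rule normed_space_closed(2)[OF dual_step_normed(2)[OF Q(3)] L R])
    fix w assume w: "w \<in> carrier (spc Q (Suc (Suc k)))"
    note pw = bounded_pair[OF Q(2) w]
    define \<alpha> where "\<alpha> x y = pair Q (Suc k) w (dual_left Q k r (T x) (D y))" for x y
    define \<beta> where "\<beta> x y = pair Q (Suc k) w (dual_right Q k l (D x) (S y))" for x y
    have \<alpha>: "bounded_bilinear_map (spc P k) (spc P k) scalars \<alpha>"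
      unfolding \<alpha>_def[abs_def]
      by (rule bounded_bilinear_map_postcompose[OF bounded_bilinear_map_compose[OF left T D] pw])
        (rule nP nQ)+
    have \<beta>: "bounded_bilinear_map (spc P k) (spc P k) scalars \<beta>"
      unfolding \<beta>_def[abs_def]
      by (rule bounded_bilinear_map_postcompose[OF bounded_bilinear_map_compose[OF right D S] pw])
        (rule nP nQ)+
    note \<alpha>_sec = bounded_bilinear_map_section[OF \<alpha>] and \<beta>_sec = bounded_bilinear_map_section[OF \<beta>]
    note \<alpha>_b = bounded_linear_bidual_eval[OF P nP(1) \<alpha> b]
      and \<beta>_b = bounded_linear_bidual_eval[OF P nP(1) \<beta> b]
    have wD: "bounded_linear_map (spc P k) scalars (\<lambda>c. pair Q (Suc k) w (D c))"
      by (rule bounded_linear_map_compose[OF D pw nP(1) nQ(2)])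

    have "pair Q (Suc (Suc k)) (?D (arens_ext P P P k m a b)) w =
        bidual_eval P k (arens_ext P P P k m a b) (\<lambda>c. pair Q (Suc k) w (D c))"
      by (rule pair_second_adj[OF P Q' D ab w])
    also have "\<dots> = bidual_eval P k a (\<lambda>x. bidual_eval P k b (\<lambda>y. pair Q (Suc k) w (D (m x y))))"
      by (rule bidual_eval_arens_ext[OF P P P m a b wD])
    also have "\<dots> = bidual_eval P k a (\<lambda>x. bidual_eval P k b (\<lambda>y. \<alpha> x y + \<beta> x y))"
      by (intro bidual_eval_cong)
        (simp add: prod \<alpha>_def \<beta>_def pair_bilinear(3)[OF Q(2) w] bounded_bilinear_mapD(1)[OF left]
          bounded_bilinear_mapD(1)[OF right] bounded_linear_mapD(1)[OF T]
          bounded_linear_mapD(1)[OF S] bounded_linear_mapD(1)[OF D])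
    also have "\<dots> = bidual_eval P k a (\<lambda>x. bidual_eval P k b (\<alpha> x) + bidual_eval P k b (\<beta> x))"
      by (intro bidual_eval_cong bidual_eval_add[OF P b] \<alpha>_sec \<beta>_sec)
    also have "\<dots> = bidual_eval P k a (\<lambda>x. bidual_eval P k b (\<alpha> x))
        + bidual_eval P k a (\<lambda>x. bidual_eval P k b (\<beta> x))"
      by (rule bidual_eval_add[OF P a \<alpha>_b \<beta>_b])
    finally have lhs: "pair Q (Suc (Suc k)) (?D (arens_ext P P P k m a b)) w =
        bidual_eval P k a (\<lambda>x. bidual_eval P k b (\<alpha> x)) +
        bidual_eval P k a (\<lambda>x. bidual_eval P k b (\<beta> x))" .

    have "pair Q (Suc (Suc k)) (dual_right Q (Suc (Suc k)) ?l (?D a) (?S b)) w =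
        pair Q (Suc (Suc k)) (?D a) (?l (?S b) w)"
      by (rule pair_dual_right[OF Q(3) nP(3) l2 Sb Da w])
    also have "\<dots> = bidual_eval P k a (\<lambda>x. pair Q (Suc k) (?l (?S b) w) (D x))"
      by (rule pair_second_adj[OF P Q' D a bounded_bilinear_mapD(1)[OF l2 Sb w]])
    also have "\<dots> = bidual_eval P k a (\<lambda>x. bidual_eval P k b (\<beta> x))"
    proof (rule bidual_eval_cong)
      fix x assume x: "x \<in> carrier (spc P k)"
      note Dx = bounded_linear_mapD(1)[OF D x]
      have "bounded_linear_map (spc P k) scalars (\<lambda>c. pair Q (Suc k) w (dual_right Q k l (D x) c))"
        by (rule bounded_linear_map_compose[OF bounded_bilinear_map_section[OF right Dx] pw nP(1) nQ(2)])
      note form = this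
      have "pair Q (Suc k) (?l (?S b) w) (D x) =
          bidual_eval P k (?S b) (\<lambda>c. bidual_eval Q k w (\<lambda>y. pair Q k (D x) (l c y)))"
        by (rule pair_arens_ext[OF P Q01 Q01 l Sb w Dx])
      also have "\<dots> = bidual_eval P k (?S b) (\<lambda>c. pair Q (Suc k) w (dual_right Q k l (D x) c))"
        by (simp add: bidual_eval_def[of Q] dual_right_def)
      also have "\<dots> = bidual_eval P k b (\<beta> x)"
        unfolding \<beta>_def by (rule bidual_eval_second_adj[OF P P S b form])
      finally show "pair Q (Suc k) (?l (?S b) w) (D x) = bidual_eval P k b (\<beta> x)" .
    qed
    finally have rhs_S: "pair Q (Suc (Suc k)) (dual_right Q (Suc (Suc k)) ?l (?D a) (?S b)) w =
        bidual_eval P k a (\<lambda>x. bidual_eval P k b (\<beta> x))" .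

    have "pair Q (Suc (Suc k)) (dual_left Q (Suc (Suc k)) ?r (?T a) (?D b)) w =
        pair Q (Suc (Suc k)) (?D b) (?r w (?T a))"
      by (rule pair_dual_left[OF Q(3) nP(3) r2 Ta Db w])
    also have "\<dots> = bidual_eval P k a (\<lambda>x. bidual_eval P k b (\<alpha> x))"
    proof (rule continuous_eval_canon[OF P Q(3) cont[OF w] Db a \<alpha>_b])
      fix x assume x: "x \<in> carrier (spc P k)"
      note Tx = bounded_linear_mapD(1)[OF T x]
      note cTx = canon_closed[OF P Tx]
      have "pair Q (Suc (Suc k)) (?D b) (?r w (?T (canon P k x))) =
          pair Q (Suc (Suc k)) (?D b) (?r w (canon P k (T x)))"
        by (simp add: second_adj_canon[OF P P T x])
      also have "\<dots> = bidual_eval P k b (\<lambda>y. pair Q (Suc k) (?r w (canon P k (T x))) (D y))"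
        by (rule pair_second_adj[OF P Q' D b bounded_bilinear_mapD(1)[OF r2 w cTx]])
      also have "\<dots> = bidual_eval P k b (\<alpha> x)"
      proof (rule bidual_eval_cong)
        fix y assume y: "y \<in> carrier (spc P k)"
        note Dy = bounded_linear_mapD(1)[OF D y]
        have "pair Q (Suc k) (?r w (canon P k (T x))) (D y) =
            bidual_eval Q k w (\<lambda>v. bidual_eval P k (canon P k (T x)) (\<lambda>c. pair Q k (D y) (r v c)))"
          by (rule pair_arens_ext[OF Q01 P Q01 r w cTx Dy])
        also have "\<dots> = bidual_eval Q k w (\<lambda>v. pair Q k (D y) (r v (T x)))"
          by (intro bidual_eval_cong bidual_eval_canon[OF P Tx]
              bounded_linear_map_compose[OF bounded_bilinear_map_section[OF r] bounded_pair[OF Q(1) Dy]]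
              nP nQ)
        also have "\<dots> = \<alpha> x y"
          by (simp add: bidual_eval_def[of Q] dual_left_def \<alpha>_def)
        finally show "pair Q (Suc k) (?r w (canon P k (T x))) (D y) = \<alpha> x y" .
      qed
      finally show "pair Q (Suc (Suc k)) (?D b) (?r w (?T (canon P k x))) = bidual_eval P k b (\<alpha> x)" .
    qed
    finally have rhs_T: "pair Q (Suc (Suc k)) (dual_left Q (Suc (Suc k)) ?r (?T a) (?D b)) w =
        bidual_eval P k a (\<lambda>x. bidual_eval P k b (\<alpha> x))" .

    show "pair Q (Suc (Suc k)) (?D (arens_ext P P P k m a b)) w = pair Q (Suc (Suc k))
        (dual_left Q (Suc (Suc k)) ?r (?T a) (?D b) + dual_right Q (Suc (Suc k)) ?l (?D a) (?S b)) w"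
      by (simp add: lhs rhs_T rhs_S pair_bilinear(1)[OF Q(3) L R w])
  qed
  show ?thesis
    using T2 S2 D2 main by (simp add: ts_derivation_def)
qed

lemma bounded_bilinear_map_cong:
  assumes "normed_space E" "normed_space F"
    and "\<And>x y. x \<in> carrier E \<Longrightarrow> y \<in> carrier F \<Longrightarrow> h x y = h' x y"
    and "bounded_bilinear_map E F G h"
  shows "bounded_bilinear_map E F G h'"
  using assms(3,4) normed_space_closed[OF assms(1)] normed_space_closed[OF assms(2)]
  by (simp add: bounded_bilinear_map_def bilinear_map_def linear_map_def)

lemma bounded_even_operations:
  fixes P :: "('k::{real_normed_field, euclidean_space}, 'u::ab_group_add) tower"
    and Q :: "('k, 'v::ab_group_add) tower"
  assumes P: "dual_tower N P" and Q: "dual_tower N Q"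
    and alg: "banach_algebra (spc P 0) m" and mod: "banach_bimodule (spc P 0) m (spc Q 0) l r"
    and "even n" "n \<le> N"
  shows "bounded_bilinear_map (spc P n) (spc P n) (spc P n) (alg_mult P m n) \<and>
    bounded_bilinear_map (spc P n) (spc Q n) (spc Q n) (left_act P Q l n) \<and>
    bounded_bilinear_map (spc Q n) (spc P n) (spc Q n) (right_act P Q r n)"
  using assms(5,6)
proof (induction n rule: induct_nat_012)
  case 0
  have nP: "normed_space (spc P 0)" and nQ: "normed_space (spc Q 0)"
    using alg mod by (auto simp: banach_algebra_def banach_bimodule_def banach_space_def)
  obtain K where K: "\<And>a y. a \<in> carrier (spc P 0) \<Longrightarrow> y \<in> carrier (spc Q 0) \<Longrightarrow>
      nrm (spc Q 0) (l a y) \<le> K * nrm (spc P 0) a * nrm (spc Q 0) y \<and>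
      nrm (spc Q 0) (r y a) \<le> K * nrm (spc P 0) a * nrm (spc Q 0) y"
    using mod unfolding banach_bimodule_def by blast
  have K': "nrm (spc Q 0) (l a y) \<le> \<bar>K\<bar> * nrm (spc P 0) a * nrm (spc Q 0) y \<and>
      nrm (spc Q 0) (r y a) \<le> \<bar>K\<bar> * nrm (spc Q 0) y * nrm (spc P 0) a"
    if "a \<in> carrier (spc P 0)" "y \<in> carrier (spc Q 0)" for a y
  proof -
    have "K * (nrm (spc P 0) a * nrm (spc Q 0) y) \<le> \<bar>K\<bar> * (nrm (spc P 0) a * nrm (spc Q 0) y)"
      using normed_space_nrm(1)[OF nP that(1)] normed_space_nrm(1)[OF nQ that(2)]
      by (intro mult_right_mono) auto
    then show ?thesis using K[OF that] by (auto simp: mult_ac)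
  qed
  have "nrm (spc P 0) (m a b) \<le> 1 * nrm (spc P 0) a * nrm (spc P 0) b"
    if "a \<in> carrier (spc P 0)" "b \<in> carrier (spc P 0)" for a b
    using alg that by (simp add: banach_algebra_def)
  then have "bounded_bilinear_map (spc P 0) (spc P 0) (spc P 0) m"
    using alg zero_le_one unfolding banach_algebra_def bounded_bilinear_map_def by blast
  moreover have "bounded_bilinear_map (spc P 0) (spc Q 0) (spc Q 0) l"
    "bounded_bilinear_map (spc Q 0) (spc P 0) (spc Q 0) r"
    using mod K' abs_ge_zero unfolding banach_bimodule_def bounded_bilinear_map_def by blast+
  ultimately show ?case by simp
next
  case 1
  then show ?case by simp
next
  case (ge2 n)
  have sP: "dual_step P n" "dual_step P (Suc n)" and sQ: "dual_step Q n" "dual_step Q (Suc n)"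
    using ge2.prems dual_tower_step[OF P] dual_tower_step[OF Q] by auto
  note nP = dual_step_normed(2)[OF sP(2)] and nQ = dual_step_normed(2)[OF sQ(2)]
  have m: "bounded_bilinear_map (spc P n) (spc P n) (spc P n) (alg_mult P m n)"
    and l: "bounded_bilinear_map (spc P n) (spc Q n) (spc Q n) (left_act P Q l n)"
    and r: "bounded_bilinear_map (spc Q n) (spc P n) (spc Q n) (right_act P Q r n)"
    using ge2 by auto
  have "bounded_bilinear_map (spc P (Suc (Suc n))) (spc P (Suc (Suc n))) (spc P (Suc (Suc n)))
      (alg_mult P m (Suc (Suc n)))"
    using bounded_bilinear_arens_ext[OF sP sP sP m] by (simp add: arens_eq_arens_ext)
  moreover have "bounded_bilinear_map (spc P (Suc (Suc n))) (spc Q (Suc (Suc n))) (spc Q (Suc (Suc n)))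
      (left_act P Q l (Suc (Suc n)))"
    by (rule bounded_bilinear_map_cong[OF nP nQ _ bounded_bilinear_arens_ext[OF sP sQ sQ l]])
      (simp add: bidual_left_eq_arens_ext sP sQ l)
  moreover have "bounded_bilinear_map (spc Q (Suc (Suc n))) (spc P (Suc (Suc n))) (spc Q (Suc (Suc n)))
      (right_act P Q r (Suc (Suc n)))"
    by (rule bounded_bilinear_map_cong[OF nQ nP _ bounded_bilinear_arens_ext[OF sQ sP sQ r]])
      (simp add: bidual_right_eq_arens_ext sP sQ r)
  ultimately show ?case by blast
qed

theorem mainTheorem2:
  fixes A :: "('k::{real_normed_field, euclidean_space}, 'u::ab_group_add) tower"
    and X :: "('k, 'v::ab_group_add) tower"
    and mult :: "'u \<Rightarrow> 'u \<Rightarrow> 'u"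
    and l :: "'u \<Rightarrow> 'v \<Rightarrow> 'v" and r :: "'v \<Rightarrow> 'u \<Rightarrow> 'v"
    and n :: nat
    and T S :: "'u \<Rightarrow> 'u" and D :: "'u \<Rightarrow> 'v"
  assumes "even n"
    and "dual_tower (n + 2) A"
    and "dual_tower (n + 3) X"
    and "banach_algebra (spc A 0) mult"
    and "banach_bimodule (spc A 0) mult (spc X 0) l r"
    and "bounded_linear_map (spc A n) (spc A n) T"
    and "bounded_linear_map (spc A n) (spc A n) S"
    and "\<forall>x\<in>carrier (spc X (n + 2)).
           continuous_map (weak_star_top A (n + 1)) (weak_top X (n + 2))
             (\<lambda>a. right_act A X r (n + 2) x (second_adj A n A n T a))"
    and "ts_derivation (spc A n) (alg_mult A mult n) (spc X (n + 1))
           (dual_left X n (right_act A X r n)) (dual_right X n (left_act A X l n)) T S D"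
  shows "ts_derivation (spc A (n + 2)) (alg_mult A mult (n + 2)) (spc X (n + 3))
           (dual_left X (n + 2) (right_act A X r (n + 2)))
           (dual_right X (n + 2) (left_act A X l (n + 2)))
           (second_adj A n A n T) (second_adj A n A n S) (second_adj A n X (n + 1) D)"
proof -
  have sA: "dual_step A n" "dual_step A (Suc n)"
    using dual_tower_step[OF assms(2)] by simp_all
  have sX: "dual_step X n" "dual_step X (Suc n)" "dual_step X (Suc (Suc n))"
    using dual_tower_step[OF assms(3)] by simp_all
  have A: "dual_tower n A" and X: "dual_tower n X" using assms(2,3) by (auto simp: dual_tower_def)
  let ?m = "alg_mult A mult n" and ?l = "left_act A X l n" and ?r = "right_act A X r n"
  have m: "bounded_bilinear_map (spc A n) (spc A n) (spc A n) ?m"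
    and l: "bounded_bilinear_map (spc A n) (spc X n) (spc X n) ?l"
    and r: "bounded_bilinear_map (spc X n) (spc A n) (spc X n) ?r"
    using bounded_even_operations[OF A X assms(4,5,1)] by auto
  note T2 = bounded_linear_second_adj[OF sA sA assms(6)]
    and S2 = bounded_linear_second_adj[OF sA sA assms(7)]
  have top: "topspace (weak_star_top A (Suc n)) = carrier (spc A (Suc (Suc n)))"
    using topspace_sigma_top[OF carrier_nonempty[OF sA(2)]] by (simp add: weak_star_top_def)
  have cont: "continuous_map (weak_star_top A (Suc n)) (weak_top X (Suc (Suc n)))
      (\<lambda>a. arens_ext X A X n ?r x (second_adj A n A n T a))"
    if x: "x \<in> carrier (spc X (Suc (Suc n)))" for x
  proof (rule continuous_map_eq)
    show "continuous_map (weak_star_top A (Suc n)) (weak_top X (Suc (Suc n)))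
        (\<lambda>a. right_act A X r (n + 2) x (second_adj A n A n T a))"
      using assms(8) x by simp
    fix a assume "a \<in> topspace (weak_star_top A (Suc n))"
    then show "right_act A X r (n + 2) x (second_adj A n A n T a) =
        arens_ext X A X n ?r x (second_adj A n A n T a)"
      using bounded_linear_mapD(1)[OF T2] top by (simp add: bidual_right_eq_arens_ext sA sX(1,2) r x)
  qed
  have der: "ts_derivation (spc A n) ?m (spc X (Suc n)) (dual_left X n ?r) (dual_right X n ?l) T S D"
    using assms(9) by simp
  note main = ts_derivation_second_adj[OF sA sX m l r cont der]
  have left: "dual_left X (Suc (Suc n)) (bidual_right A X n ?r) b =
      dual_left X (Suc (Suc n)) (arens_ext X A X n ?r) b"
    if "b \<in> carrier (spc A (Suc (Suc n)))" for b
    unfolding dual_left_def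
    by (intro ext functional_cong) (simp add: bidual_right_eq_arens_ext sA sX(1,2) r that)
  have right: "dual_right X (Suc (Suc n)) (bidual_left A X n ?l) y b =
      dual_right X (Suc (Suc n)) (arens_ext A X X n ?l) y b"
    if "b \<in> carrier (spc A (Suc (Suc n)))" for b y
    unfolding dual_right_def
    by (intro functional_cong) (simp add: bidual_left_eq_arens_ext sA sX(1,2) l that)
  show ?thesis
    using main bounded_linear_mapD(1)[OF T2] bounded_linear_mapD(1)[OF S2]
    by (simp add: ts_derivation_def arens_eq_arens_ext left right numeral_3_eq_3)
qed

end
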